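(* Let $n\ge2$, let $G\subset\mathbb{R}^n$ be a non-empty open set with non-empty boundary, and assume that $1\le p\le q<np/(n-p)<\infty$ and $\beta\ge0$ are such that $q(n-p+\beta)/p\neq n$ and $G$ admits a $(q,p,\beta)$-Hardy--Sobolev inequality. Then for each closed ball $B=\overline{B}(x,R)\subset\mathbb{R}^n$ either $$\overline{\dim}_A(G^c\cap B)<\frac{q}{p}(n-p+\beta)\quad\text{or}\quad \dim_H(G^c\cap 2B)\ge n-p+\beta.$$
   Context: $G^c=\mathbb{R}^n\setminus G$, $\delta_{\partial G}(x)=\operatorname{dist}(x,\partial G)$, $\overline{B}(x,R)$ is the closed ball with center $x$ and radius $R>0$, $2B=\overline{B}(x,2R)$, $\dim_H$ is Hausdorff dimension, $d(E)$ is the diameter of $E$, and $C_0^\infty(G)$ denotes smooth functions with compact support in $G$. The dimensions of the empty set are $0$. An open set $G$ admits a $(q,p,\beta)$-Hardy--Sobolev inequality if there is a constant $C>0$ such that $$\biggl(\int_{G} |f|^q \,\delta_{\partial G}^{(q/p)(n-p+\beta)-n}\,dx\biggr)^{1/q}\le C \biggl(\int_G |\nabla f|^p\,\delta_{\partial G}^{\beta}\,dx\biggr)^{1/p}$$ for all $f\in C_0^\infty(G)$. For bounded $A\subset\mathbb{R}^n$ and $r>0$, $N(A,r)$ is the minimal number of open balls of radius $r$ centered at points of $A$ needed to cover $A$. With $B(x,R)$ the open ball, the (upper) Assouad dimension is $\overline{\dim}_A(E)=\inf\{\lambda\ge 0:\ \exists\, C_\lambda>0 \text{ such that } N(E\cap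 B(x,R),r)\le C_\lambda (r/R)^{-\lambda}\text{ for all } x\in E,\ 0<r<R<d(E)\}$. *)

theory Defs
  imports "HOL-Analysis.Analysis"
begin

fun C_k :: "nat \<Rightarrow> ('a::euclidean_space \<Rightarrow> real) \<Rightarrow> bool" where
  "C_k 0 f \<longleftrightarrow> continuous_on UNIV f"
| "C_k (Suc k) f \<longleftrightarrow> (\<forall>x. f differentiable (at x)) \<and>
     (\<forall>b\<in>Basis. C_k k (\<lambda>x. frechet_derivative f (at x) b))"

text \<open>Functions in \<open>C\<^sub>0\<^sup>\<infinity>(G)\<close> are represented by their extension by zero to the whole space.\<close>

definition test_function_on :: "'a::euclidean_space set \<Rightarrow> ('a \<Rightarrow> real) \<Rightarrow> bool" where
  "test_function_on G f \<longleftrightarrow>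
     (\<forall>k. C_k k f) \<and> compact (closure {x. f x \<noteq> 0}) \<and> closure {x. f x \<noteq> 0} \<subseteq> G"

definition grad :: "('a::euclidean_space \<Rightarrow> real) \<Rightarrow> 'a \<Rightarrow> 'a" where
  "grad f x = (THE D. GDERIV f x :> D)"

text \<open>
  The definition is meant for open \<open>G\<close> with non-empty boundary and for \<open>p, q \<ge> 1\<close>. Then the distance
  to the boundary is positive and continuous on \<open>G\<close>, so both integrands are continuous with
  compact support in \<open>G\<close>; in particular they are integrable and the Bochner integrals below
  are not default values.
\<close>

definition admits_Hardy_Sobolev ::
    "'a::euclidean_space set \<Rightarrow> real \<Rightarrow> real \<Rightarrow> real \<Rightarrow> bool" where
  "admits_Hardy_Sobolev G q p \<beta> \<longleftrightarrow>
     (\<exists>C>0. \<forall>f. test_function_on G f \<longrightarrow>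
        (LINT x:G|lborel. \<bar>f x\<bar> powr q *
            infdist x (frontier G) powr ((q / p) * (real DIM('a) - p + \<beta>) - real DIM('a))) powr (1 / q)
        \<le> C * (LINT x:G|lborel. norm (grad f x) powr p *
            infdist x (frontier G) powr \<beta>) powr (1 / p))"

text \<open>
  The \<open>s\<close>-th power of the diameter of a bounded set, with the usual conventions that the empty
  set contributes \<open>0\<close> and that \<open>0\<^sup>0 = 1\<close> (whereas \<open>0 powr 0 = 0\<close>).
\<close>

definition diameter_powr :: "'a::metric_space set \<Rightarrow> real \<Rightarrow> ennreal" where
  "diameter_powr U s =
     (if U = {} then 0 else if s = 0 then 1 else ennreal (diameter U powr s))"

text \<open>Boundedness is required explicitly because \<open>diameter\<close> is unspecified on unbounded sets.\<close>

definition hausdorff_premeasure :: "real \<Rightarrow> real \<Rightarrow> 'a::metric_space set \<Rightarrow> ennreal" where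
  "hausdorff_premeasure s \<delta> A =
     Inf {(\<Sum>i. diameter_powr (U i) s) | U :: nat \<Rightarrow> 'a set.
            A \<subseteq> (\<Union>i. U i) \<and> (\<forall>i. bounded (U i) \<and> diameter (U i) \<le> \<delta>)}"

definition hausdorff_measure :: "real \<Rightarrow> 'a::metric_space set \<Rightarrow> ennreal" where
  "hausdorff_measure s A = (SUP \<delta>\<in>{0<..}. hausdorff_premeasure s \<delta> A)"

definition hausdorff_dim :: "'a::metric_space set \<Rightarrow> ereal" where
  "hausdorff_dim A = Inf {ereal s | s. 0 \<le> s \<and> hausdorff_measure s A = 0}"

text \<open>
  Bounded subsets of a Euclidean space are totally bounded, so for bounded \<open>A\<close> and \<open>r > 0\<close>
  the minimum below is attained.
\<close>

definition covering_number :: "'a::euclidean_space set \<Rightarrow> real \<Rightarrow> nat" where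
  "covering_number A r =
     (LEAST k. \<exists>S. S \<subseteq> A \<and> finite S \<and> card S = k \<and> A \<subseteq> (\<Union>x\<in>S. ball x r))"

text \<open>
  The condition \<open>bounded E \<longrightarrow> R < diameter E\<close> expresses \<open>R < d(E)\<close>, where \<open>d(E) = \<infinity>\<close> if \<open>E\<close> is
  unbounded.
\<close>

definition assouad_dim :: "'a::euclidean_space set \<Rightarrow> ereal" where
  "assouad_dim E = Inf {ereal l | l. 0 \<le> l \<and>
     (\<exists>C>0. \<forall>x\<in>E. \<forall>r R. 0 < r \<and> r < R \<and> (bounded E \<longrightarrow> R < diameter E) \<longrightarrow>
        real (covering_number (E \<inter> ball x R) r) \<le> C * (r / R) powr (- l))}"

end

theory Submission
  imports Defs
begin

text \<open>
  Put \<open>n\<close> for the dimension, \<open>s = n - p + \<beta>\<close> and \<open>Q = (q / p) s\<close>, so that \<open>s \<le> Q\<close> and \<open>Q \<noteq> n\<close>. If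
  \<open>Q > n\<close>, the first alternative holds because a bounded subset of \<open>n\<close>-space has Assouad dimension at most
  \<open>n\<close> (\<open>assouad_dim_le_DIM\<close>). Let \<open>Q < n\<close>, and suppose that the second alternative fails, that is,
  \<open>- G \<inter> 2B\<close> has Hausdorff dimension less than \<open>s\<close>.

  Such a set cannot be seen by the right-hand side of the Hardy--Sobolev inequality. A ball of radius
  \<open>\<rho>\<close> centred outside \<open>G\<close> can be cut out by a function whose gradient has size \<open>1 / \<rho>\<close> and lives on
  a ball of radius \<open>2\<rho>\<close>, where the distance to the boundary is at most \<open>2\<rho>\<close>; the weighted energy of
  that function is at most a multiple of \<open>\<rho>\<^sup>n \<rho>\<^sup>-\<^sup>p \<rho>\<^sup>\<beta> = \<rho>\<^sup>s\<close>. The set \<open>- G \<inter> 2B\<close> is compact and has covers by finitely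
  many balls with \<open>\<Sum> \<rho>\<^sub>i\<^sup>s\<close> as small as desired, so it can be cut out at no cost
  (\<open>exists_cutoff\<close>, \<open>cutoff_energy_le\<close>). Testing the inequality with a bump function at \<open>y \<in> - G \<inter> B\<close> of
  radius \<open>r\<close>, cut out in this way, therefore gives the Aikawa condition
  \[ \int_{B(y,r)} \mathrm{dist}(x, - G)^{Q-n}\,dx \le C r^Q \]
  (\<open>Hardy_Sobolev_imp_Aikawa\<close>); the exponents match because \<open>(r\<^sup>s)\<^bsup>q/p\<^esup> = r\<^sup>Q\<close>.

  The Aikawa condition bounds the number of balls of radius \<open>r / k\<close> needed to cover \<open>- G \<inter> B(y,r)\<close> by
  a multiple of \<open>k\<^sup>Q\<close>, which only gives the weak inequality \<open>dim\<^sub>A \<le> Q\<close>. The strict one comes from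
  using many scales at once. For a small ratio \<open>\<eta>\<close>, half of each ball of radius \<open>\<sigma>\<close> centred in
  \<open>- G \<inter> B\<close> lies in the shell where the distance to \<open>- G\<close> is between \<open>\<eta> \<sigma>\<close> and \<open>\<sigma>\<close>
  (\<open>Aikawa_shell\<close>), and the shells of the scales \<open>\<eta> r, \<eta>\<^sup>2 r, \<dots>\<close> are disjoint. So the single integral
  over \<open>B(y,2r)\<close> controls the sum over all scales of the normalised covering numbers
  (\<open>Aikawa_multiscale_sum\<close>). Among sufficiently many scales one has a normalised covering number of at
  most \<open>1/2\<close>, and the factor \<open>1/2\<close> leaves room to lower the exponent from \<open>Q\<close> to some \<open>l < Q\<close>
  (\<open>Aikawa_imp_efficient_covers\<close>). Iterating these covers gives \<open>dim\<^sub>A \<le> l < Q\<close>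
  (\<open>Aikawa_imp_assouad_dim_less\<close>).
\<close>


section \<open>Functions of class \<open>C\<^sup>k\<close>\<close>

lemma C_k_SucI:
  assumes "\<And>x. (f has_derivative f' x) (at x)" and "\<And>b. b \<in> Basis \<Longrightarrow> C_k k (\<lambda>x. f' x b)"
  shows "C_k (Suc k) f"
proof -
  have "frechet_derivative f (at x) = f' x" for x
    using assms(1) by (metis frechet_derivative_at)
  then show ?thesis
    using assms by (auto simp: differentiable_def)
qed

lemma C_k_Suc_imp_C_k: "C_k (Suc k) f \<Longrightarrow> C_k k f"
proof (induction k arbitrary: f)
  case 0
  then show ?case
    by (auto intro!: continuous_at_imp_continuous_on differentiable_imp_continuous_within)
next
  case (Suc k)
  then show ?case by (metis C_k.simps(2))
qed

lemma C_k_const: "C_k k (\<lambda>x. c)"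
  by (induction k arbitrary: c) (auto intro!: C_k_SucI[where f' = "\<lambda>x h. 0"] simp del: C_k.simps(2))

lemma C_k_inner_left: "C_k k (\<lambda>x. x \<bullet> a)"
proof (cases k)
  case (Suc j)
  show ?thesis
    unfolding Suc by (rule C_k_SucI[where f' = "\<lambda>x h. h \<bullet> a"]) (auto intro!: derivative_eq_intros C_k_const)
qed (auto intro!: continuous_intros)

lemma C_k_add: "C_k k f \<Longrightarrow> C_k k g \<Longrightarrow> C_k k (\<lambda>x. f x + g x)"
proof (induction k arbitrary: f g)
  case 0
  then show ?case by (auto intro!: continuous_intros)
next
  case (Suc k)
  show ?case
  proof (rule C_k_SucI)
    fix x
    show "((\<lambda>x. f x + g x) has_derivative
       (\<lambda>h. frechet_derivative f (at x) h + frechet_derivative g (at x) h)) (at x)"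
      using Suc.prems by (intro has_derivative_add) (auto simp: frechet_derivative_works[symmetric])
  qed (use Suc in auto)
qed

lemma C_k_mult: "C_k k f \<Longrightarrow> C_k k g \<Longrightarrow> C_k k (\<lambda>x. f x * g x)"
proof (induction k arbitrary: f g)
  case 0
  then show ?case by (auto intro!: continuous_intros)
next
  case (Suc k)
  show ?case
  proof (rule C_k_SucI)
    fix x
    show "((\<lambda>x. f x * g x) has_derivative
       (\<lambda>h. f x * frechet_derivative g (at x) h + frechet_derivative f (at x) h * g x)) (at x)"
      using Suc.prems by (intro has_derivative_mult) (auto simp: frechet_derivative_works[symmetric])
  qed (use Suc C_k_Suc_imp_C_k[OF Suc.prems(1)] C_k_Suc_imp_C_k[OF Suc.prems(2)] in \<open>auto intro!: C_k_add\<close>)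
qed

lemma C_k_sum:
  assumes "\<And>i. i \<in> I \<Longrightarrow> C_k k (f i)"
  shows "C_k k (\<lambda>x. \<Sum>i\<in>I. f i x)"
  using assms by (induction I rule: infinite_finite_induct) (auto intro: C_k_const C_k_add)

lemma C_k_power: "C_k k f \<Longrightarrow> C_k k (\<lambda>x. f x ^ m)"
  by (induction m) (auto intro: C_k_const C_k_mult)

text \<open>
  The outer function is given together with all its derivatives as a sequence \<open>D\<close>: the chain rule
  turns \<open>D j\<close> into \<open>D (Suc j)\<close>, so an induction on \<open>k\<close> has to treat all members of the sequence at once.
\<close>

lemma C_k_compose:
  assumes D: "\<And>j t. (D j has_real_derivative D (Suc j) t) (at t)"
    and "C_k k g"
  shows "C_k k (\<lambda>x. D j (g x))"
  using assms(2)
proof (induction k arbitrary: j)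
  case 0
  have "continuous_on UNIV (D j)"
    using D DERIV_isCont by (blast intro: continuous_at_imp_continuous_on)
  then show ?case
    using 0 by (auto intro: continuous_on_compose2)
next
  case (Suc k)
  show ?case
  proof (rule C_k_SucI)
    fix x
    have "(g has_derivative frechet_derivative g (at x)) (at x)"
      using Suc.prems by (auto simp: frechet_derivative_works[symmetric])
    from DERIV_compose_FDERIV[OF D this]
    show "((\<lambda>x. D j (g x)) has_derivative
       (\<lambda>h. frechet_derivative g (at x) h * D (Suc j) (g x))) (at x)" .
  qed (use Suc C_k_Suc_imp_C_k[OF Suc.prems] in \<open>auto intro!: C_k_mult\<close>)
qed


section \<open>A smooth function that is flat at the origin\<close>

text \<open>
  The functions \<open>P(1/t) exp(-1/t)\<close>, extended by \<open>0\<close> to \<open>t \<le> 0\<close>. The case \<open>P = 1\<close> is the standard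
  smooth function that is not analytic at \<open>0\<close>. Allowing a polynomial \<open>P\<close> makes the family closed under
  differentiation, which is how smoothness is proved.
\<close>

definition flat_exp :: "real poly \<Rightarrow> real \<Rightarrow> real" where
  "flat_exp P t = (if t \<le> 0 then 0 else poly P (1 / t) * exp (- (1 / t)))"

lemma poly_times_exp_minus_tendsto_0:
  "((\<lambda>X. poly P X * exp (- X)) \<longlongrightarrow> (0::real)) at_top"
proof -
  have "((\<lambda>X. \<Sum>i\<le>degree P. coeff P i * (X ^ i / exp X)) \<longlongrightarrow> (\<Sum>i\<le>degree P. coeff P i * 0)) at_top"
    by (intro tendsto_intros tendsto_power_div_exp_0)
  then show ?thesis
    by (simp add: poly_altdef sum_distrib_right exp_minus divide_inverse mult.assoc)
qed

text \<open>
  For \<open>t > 0\<close>, the derivative of \<open>P(X) exp(-X)\<close> with \<open>X = 1/t\<close> is \<open>-X\<^sup>2 (P'(X) - P(X)) exp(-X)\<close>. At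
  \<open>t = 0\<close> the difference quotient is again a polynomial in \<open>X\<close> times \<open>exp(-X)\<close>, so it tends to \<open>0\<close>.
\<close>

lemma flat_exp_has_derivative:
  "(flat_exp P has_real_derivative flat_exp (monom 1 2 * (P - pderiv P)) t) (at t)"
proof -
  consider "t < 0" | "t > 0" | "t = 0" by linarith
  then show ?thesis
  proof cases
    case 1
    have "((\<lambda>t. 0) has_real_derivative 0) (at t)" by simp
    then have "(flat_exp P has_real_derivative 0) (at t)"
      by (rule has_field_derivative_transform_within_open[where S = "{..<0}"])
         (use 1 in \<open>auto simp: flat_exp_def\<close>)
    then show ?thesis using 1 by (simp add: flat_exp_def)
  next
    case 2
    have "((\<lambda>t. poly P (1 / t) * exp (- (1 / t))) has_real_derivative
        flat_exp (monom 1 2 * (P - pderiv P)) t) (at t)"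
      using 2 by (auto intro!: derivative_eq_intros DERIV_chain'[OF _ poly_DERIV]
        simp: flat_exp_def poly_monom power2_eq_square field_simps)
    then show ?thesis
      by (rule has_field_derivative_transform_within_open[where S = "{0<..}"])
         (use 2 in \<open>auto simp: flat_exp_def\<close>)
  next
    case 3
    have "((\<lambda>h. poly (pCons 0 P) (inverse h) * exp (- inverse h)) \<longlongrightarrow> 0) (at_right 0)"
      by (rule filterlim_compose[OF poly_times_exp_minus_tendsto_0 filterlim_inverse_at_top_right])
    then have "((\<lambda>h. flat_exp P h / h) \<longlongrightarrow> 0) (at_right 0)"
      by (rule Lim_transform_eventually)
         (auto simp: flat_exp_def eventually_at_filter field_simps)
    moreover have "((\<lambda>h. flat_exp P h / h) \<longlongrightarrow> 0) (at_left 0)"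
      by (rule Lim_transform_eventually[OF tendsto_const])
         (auto simp: flat_exp_def eventually_at_filter)
    ultimately have "((\<lambda>h. flat_exp P h / h) \<longlongrightarrow> 0) (at 0)"
      by (simp add: filterlim_at_split)
    then show ?thesis using 3
      by (simp add: DERIV_def flat_exp_def)
  qed
qed

definition flat_deriv_poly :: "nat \<Rightarrow> real poly" where
  "flat_deriv_poly j = ((\<lambda>P. monom 1 2 * (P - pderiv P)) ^^ j) 1"

lemma C_k_flat_exp:
  assumes "C_k k g"
  shows "C_k k (\<lambda>x. flat_exp 1 (g x))"
proof -
  have "(flat_exp (flat_deriv_poly j) has_real_derivative flat_exp (flat_deriv_poly (Suc j)) t) (at t)" for j t
    using flat_exp_has_derivative by (simp add: flat_deriv_poly_def)
  from C_k_compose[of "\<lambda>j. flat_exp (flat_deriv_poly j)", OF this assms, of 0]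
  show ?thesis by (simp add: flat_deriv_poly_def)
qed


section \<open>Bump functions and cutoffs\<close>

lemma flat_exp_one_has_derivative:
  "(flat_exp 1 has_real_derivative flat_exp (monom 1 2) t) (at t)"
  using flat_exp_has_derivative[of 1 t] by simp

lemma flat_exp_one_nonneg: "0 \<le> flat_exp 1 t"
  and flat_exp_one_le_1: "flat_exp 1 t \<le> 1"
  by (auto simp: flat_exp_def)

lemma flat_exp_deriv_nonneg: "0 \<le> flat_exp (monom 1 2) t"
  by (auto simp: flat_exp_def poly_monom)

text \<open>
  With \<open>X = 1/t\<close> this is \<open>X\<^sup>2 \<le> 2 exp X\<close>, part of the quadratic Taylor bound.
\<close>

lemma flat_exp_deriv_le_2: "flat_exp (monom 1 2) t \<le> 2"
proof (cases "t \<le> 0")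
  case False
  have "(1 / t)\<^sup>2 \<le> 2 * exp (1 / t)"
    using exp_lower_Taylor_quadratic[of "1 / t"] False divide_pos_pos[of 1 t] by linarith
  then show ?thesis
    using False by (simp add: flat_exp_def poly_monom exp_minus field_simps)
qed (auto simp: flat_exp_def)

text \<open>
  The factor \<open>exp (1/3)\<close> makes the value \<open>1\<close> at distance \<open>r\<close> from the centre \<open>z\<close>, where the argument of
  \<open>flat_exp\<close> is \<open>3\<close>. Inside \<open>ball z r\<close> the bump is only bounded below by \<open>1\<close>, not equal to \<open>1\<close>.
\<close>

definition bump :: "'a::euclidean_space \<Rightarrow> real \<Rightarrow> 'a \<Rightarrow> real" where
  "bump z r x = exp (1 / 3) * flat_exp 1 (4 - (x - z) \<bullet> (x - z) / r\<^sup>2)"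

definition grad_bump :: "'a::euclidean_space \<Rightarrow> real \<Rightarrow> 'a \<Rightarrow> 'a" where
  "grad_bump z r x =
     (- 2 * exp (1 / 3) * flat_exp (monom 1 2) (4 - (x - z) \<bullet> (x - z) / r\<^sup>2) / r\<^sup>2) *\<^sub>R (x - z)"

lemma C_k_bump: "C_k k (bump z r)"
proof -
  have inner: "(x - z) \<bullet> (x - z) = (\<Sum>b\<in>Basis. (x \<bullet> b + - (z \<bullet> b)) * (x \<bullet> b + - (z \<bullet> b)))" for x
    by (subst euclidean_inner) (simp add: inner_diff_left)
  have "C_k k (\<lambda>x. exp (1 / 3) * flat_exp 1 (4 + (- 1 / r\<^sup>2) *
      (\<Sum>b\<in>Basis. (x \<bullet> b + - (z \<bullet> b)) * (x \<bullet> b + - (z \<bullet> b)))))"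
    by (intro C_k_mult C_k_flat_exp C_k_add C_k_sum C_k_inner_left C_k_const)
  moreover have "bump z r = (\<lambda>x. exp (1 / 3) * flat_exp 1 (4 + (- 1 / r\<^sup>2) *
      (\<Sum>b\<in>Basis. (x \<bullet> b + - (z \<bullet> b)) * (x \<bullet> b + - (z \<bullet> b)))))"
    by (rule ext) (simp add: bump_def inner)
  ultimately show ?thesis by metis
qed

lemma GDERIV_bump: "GDERIV (bump z r) x :> grad_bump z r x"
proof -
  have "GDERIV (\<lambda>x. 4 - (x - z) \<bullet> (x - z) / r\<^sup>2) x :> (- 2 / r\<^sup>2) *\<^sub>R (x - z)"
    unfolding gderiv_def
    by (auto intro!: derivative_eq_intros simp: inner_commute divide_inverse algebra_simps)
  from GDERIV_DERIV_compose[OF this DERIV_cmult[OF flat_exp_one_has_derivative, of "exp (1 / 3)"]]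
  show ?thesis by (simp add: bump_def[abs_def] grad_bump_def mult_ac)
qed

lemma in_ball_iff_inner_less:
  assumes "r > 0"
  shows "x \<in> ball z (c * r) \<longleftrightarrow> c > 0 \<and> (x - z) \<bullet> (x - z) / r\<^sup>2 < c\<^sup>2"
proof -
  have "x \<in> ball z (c * r) \<longleftrightarrow> norm (x - z) / r < c"
    using assms by (simp add: dist_norm norm_minus_commute field_simps)
  also have "\<dots> \<longleftrightarrow> c > 0 \<and> (norm (x - z) / r)\<^sup>2 < c\<^sup>2"
    using assms by (smt (verit) divide_nonneg_pos norm_ge_zero power2_less_imp_less power_strict_mono pos2)
  finally show ?thesis by (simp add: power_divide power2_norm_eq_inner)
qed

lemma bump_nonneg: "0 \<le> bump z r x"
  and bump_le: "bump z r x \<le> exp (1 / 3)"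
  by (auto simp: bump_def flat_exp_one_nonneg flat_exp_one_le_1)

lemma bump_pos_iff:
  assumes "r > 0"
  shows "0 < bump z r x \<longleftrightarrow> x \<in> ball z (2 * r)"
  unfolding in_ball_iff_inner_less[OF assms] by (auto simp: bump_def flat_exp_def)

lemma bump_ge_1:
  assumes "r > 0" "x \<in> ball z r"
  shows "1 \<le> bump z r x"
proof -
  define t where "t = 4 - (x - z) \<bullet> (x - z) / r\<^sup>2"
  have "t > 3" using in_ball_iff_inner_less[OF assms(1), of x z 1] assms by (simp add: t_def)
  then have "1 \<le> exp (1 / 3) * exp (- (1 / t))"
    by (simp add: field_simps flip: exp_add)
  then show ?thesis using \<open>t > 3\<close> by (simp add: bump_def flat_exp_def flip: t_def)
qed

lemma grad_bump_outside:
  assumes "r > 0" "x \<notin> ball z (2 * r)"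
  shows "grad_bump z r x = 0"
  using assms(2) unfolding in_ball_iff_inner_less[OF assms(1)] by (auto simp: grad_bump_def flat_exp_def)

lemma norm_grad_bump_le:
  assumes "r > 0"
  shows "norm (grad_bump z r x) \<le> 8 * exp (1 / 3) / r"
proof (cases "x \<in> ball z (2 * r)")
  case True
  then have "norm (x - z) \<le> 2 * r" by (simp add: dist_norm norm_minus_commute)
  moreover have "flat_exp (monom 1 2) (4 - (x - z) \<bullet> (x - z) / r\<^sup>2) \<le> 2"
    by (rule flat_exp_deriv_le_2)
  ultimately have "2 * exp (1 / 3) * flat_exp (monom 1 2) (4 - (x - z) \<bullet> (x - z) / r\<^sup>2) / r\<^sup>2 * norm (x - z)
      \<le> 2 * exp (1 / 3) * 2 / r\<^sup>2 * (2 * r)"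
    by (intro mult_mono divide_right_mono mult_left_mono) (auto simp: flat_exp_deriv_nonneg)
  then show ?thesis
    using assms by (simp add: grad_bump_def abs_mult flat_exp_deriv_nonneg power2_eq_square)
next
  case False
  then show ?thesis using assms grad_bump_outside[OF assms False] by simp
qed

text \<open>
  Jensen's inequality for the convex function \<open>t\<^sup>p\<close>, with weights of total mass \<open>S \<le> 1\<close> instead of
  \<open>1\<close>: normalising the weights costs a factor \<open>S\<^bsup>p-1\<^esup> \<le> 1\<close>.
\<close>

lemma powr_sum_le_sum_powr:
  fixes w t :: "'i \<Rightarrow> real"
  assumes "finite J" "p \<ge> 1" and w: "\<And>i. i \<in> J \<Longrightarrow> w i > 0" "(\<Sum>i\<in>J. w i) \<le> 1"
    and t: "\<And>i. i \<in> J \<Longrightarrow> t i > 0"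
  shows "(\<Sum>i\<in>J. w i * t i) powr p \<le> (\<Sum>i\<in>J. w i * t i powr p)"
proof (cases "J = {}")
  case False
  define S where "S = (\<Sum>i\<in>J. w i)"
  have "S > 0" unfolding S_def using False assms by (intro sum_pos) auto
  have *: "((\<Sum>i\<in>J. w i * t i) / S) powr p \<le> (\<Sum>i\<in>J. w i * t i powr p) / S"
    using convex_on_sum[OF \<open>finite J\<close> False powr_convex[OF \<open>p \<ge> 1\<close>], of "\<lambda>i. w i / S" t] w(1) t \<open>S > 0\<close>
    by (simp add: less_imp_le S_def flip: sum_divide_distrib)
  have T: "(\<Sum>i\<in>J. w i * t i) \<ge> 0" "(\<Sum>i\<in>J. w i * t i powr p) \<ge> 0"
    using assms by (auto intro!: sum_nonneg simp: less_imp_le)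
  have "(\<Sum>i\<in>J. w i * t i) powr p = S powr p * ((\<Sum>i\<in>J. w i * t i) / S) powr p"
    using \<open>S > 0\<close> T by (simp flip: powr_mult)
  also have "\<dots> \<le> S powr p * ((\<Sum>i\<in>J. w i * t i powr p) / S)"
    by (intro mult_left_mono *) auto
  also have "\<dots> = S powr (p - 1) * (\<Sum>i\<in>J. w i * t i powr p)"
    using \<open>S > 0\<close> by (simp add: powr_diff)
  also have "\<dots> \<le> 1 * (\<Sum>i\<in>J. w i * t i powr p)"
    using \<open>S > 0\<close> w(2) \<open>p \<ge> 1\<close> T by (intro mult_right_mono powr_le1) (auto simp: S_def)
  finally show ?thesis by simp
qed auto

lemma powr_add_le:
  fixes a b :: real
  assumes "a \<ge> 0" "b \<ge> 0" "p \<ge> 0"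
  shows "(a + b) powr p \<le> 2 powr p * (a powr p + b powr p)"
proof -
  have "(a + b) powr p \<le> (2 * max a b) powr p"
    using assms by (intro powr_mono2) auto
  also have "\<dots> = 2 powr p * max a b powr p"
    using assms by (simp add: powr_mult)
  also have "\<dots> \<le> 2 powr p * (a powr p + b powr p)"
    by (intro mult_left_mono) (auto simp: max_def)
  finally show ?thesis .
qed

lemma GDERIV_sum:
  assumes "\<And>i. i \<in> I \<Longrightarrow> GDERIV (f i) x :> g i"
  shows "GDERIV (\<lambda>x. \<Sum>i\<in>I. f i x) x :> (\<Sum>i\<in>I. g i)"
  using assms unfolding gderiv_def by (simp add: inner_sum_right has_derivative_sum)

lemma grad_eq:
  assumes "GDERIV f x :> D"
  shows "grad f x = D"
  unfolding grad_def
proof (rule the_equality)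
  show "GDERIV f x :> D" by fact
  fix D' assume "GDERIV f x :> D'"
  then have eq: "(\<lambda>h. h \<bullet> D') = (\<lambda>h. h \<bullet> D)"
    using assms has_derivative_unique[of f "\<lambda>h. h \<bullet> D'" x "\<lambda>h. h \<bullet> D"]
    by (simp only: gderiv_def)
  show "D' = D"
    by (rule euclidean_eqI) (use fun_cong[OF eq] in \<open>simp add: inner_commute\<close>)
qed

text \<open>
  The balls may overlap arbitrarily often, so estimating the sum of the gradients by the triangle
  inequality alone would lose a factor that depends on the number of balls. Raising the bumps \<open>u\<^sub>i\<close> to
  a power \<open>m \<ge> p\<close> avoids this: at points where \<open>\<Sum> u\<^sub>i\<^sup>m \<le> 1\<close> one can write
  \<open>u\<^sub>i\<^bsup>m-1\<^esup> / \<rho>\<^sub>i = u\<^sub>i\<^sup>m \<cdot> 1 / (u\<^sub>i \<rho>\<^sub>i)\<close> and use Jensen's inequality with the weights \<open>u\<^sub>i\<^sup>m\<close>. The resulting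
  terms are \<open>u\<^sub>i\<^bsup>m-p\<^esup> \<rho>\<^sub>i\<^bsup>-p\<^esup> \<le> \<rho>\<^sub>i\<^bsup>-p\<^esup>\<close>, that is, the \<open>p\<close>-th power of the sum is bounded by the sum
  of the \<open>p\<close>-th powers.
\<close>

lemma sum_bump_gradients_le:
  assumes "finite I" "\<And>i. i \<in> I \<Longrightarrow> \<rho> i > 0" "p \<ge> 1" "real m \<ge> p"
    and less: "(\<Sum>i\<in>I. bump (z i) (\<rho> i) x ^ m) \<le> 1"
  shows "(\<Sum>i\<in>I. bump (z i) (\<rho> i) x ^ (m - 1) * norm (grad_bump (z i) (\<rho> i) x)) powr p
    \<le> (8 * exp (1 / 3)) powr p * (\<Sum>i\<in>I. \<rho> i powr (- p) * indicator (cball (z i) (2 * \<rho> i)) x)"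
proof -
  define J where "J = {i\<in>I. x \<in> ball (z i) (2 * \<rho> i)}"
  define u where "u i = bump (z i) (\<rho> i) x" for i
  have J: "J \<subseteq> I" "finite J" using assms(1) by (auto simp: J_def)
  have u: "u i > 0" if "i \<in> J" for i
    using that assms(2) by (auto simp: J_def u_def bump_pos_iff)
  have m: "m \<ge> 1" using assms by linarith
  have um: "(\<Sum>i\<in>J. u i ^ m) \<le> 1"
  proof -
    have "(\<Sum>i\<in>J. u i ^ m) \<le> (\<Sum>i\<in>I. u i ^ m)"
      using J assms(1) by (intro sum_mono2) (auto simp: u_def bump_nonneg)
    with less show ?thesis by (simp add: u_def)
  qed
  have u_le: "u i \<le> 1" if "i \<in> J" for i
  proof -
    have "u i ^ m \<le> (\<Sum>i\<in>J. u i ^ m)"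
      using J that u by (intro member_le_sum) (auto simp: less_imp_le)
    with um have "u i ^ m \<le> 1" by simp
    then show ?thesis using m u[OF that] by (auto simp: power_le_one_iff)
  qed
  have "(\<Sum>i\<in>I. u i ^ (m - 1) * norm (grad_bump (z i) (\<rho> i) x))
      = (\<Sum>i\<in>J. u i ^ (m - 1) * norm (grad_bump (z i) (\<rho> i) x))"
    using assms(1,2) J by (intro sum.mono_neutral_right) (auto simp: J_def grad_bump_outside)
  also have "\<dots> \<le> (\<Sum>i\<in>J. u i ^ (m - 1) * (8 * exp (1 / 3) / \<rho> i))"
    using J assms(2) u by (intro sum_mono mult_left_mono norm_grad_bump_le) (auto simp: less_imp_le)
  also have "\<dots> = 8 * exp (1 / 3) * (\<Sum>i\<in>J. u i ^ m * (1 / (u i * \<rho> i)))"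
  proof -
    have "u i ^ m = u i ^ (m - 1) * u i" for i
      using m by (simp flip: power_Suc2)
    moreover have "u i \<noteq> 0" if "i \<in> J" for i
      using u[OF that] by simp
    ultimately show ?thesis
      unfolding sum_distrib_left by (intro sum.cong) auto
  qed
  finally have le: "(\<Sum>i\<in>I. u i ^ (m - 1) * norm (grad_bump (z i) (\<rho> i) x))
      \<le> 8 * exp (1 / 3) * (\<Sum>i\<in>J. u i ^ m * (1 / (u i * \<rho> i)))" .
  have \<rho>: "\<rho> i > 0" if "i \<in> J" for i using that J assms by auto
  have "(\<Sum>i\<in>J. u i ^ m * (1 / (u i * \<rho> i))) powr p \<le> (\<Sum>i\<in>J. u i ^ m * (1 / (u i * \<rho> i)) powr p)"
    using J u um \<rho> assms by (intro powr_sum_le_sum_powr) auto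
  also have "\<dots> \<le> (\<Sum>i\<in>J. \<rho> i powr (- p))"
  proof (rule sum_mono)
    fix i assume i: "i \<in> J"
    have "u i ^ m * (1 / (u i * \<rho> i)) powr p = u i powr (real m - p) * \<rho> i powr (- p)"
      using u[OF i] \<rho>[OF i]
      by (simp add: powr_divide powr_mult powr_diff powr_minus_divide powr_realpow)
    also have "\<dots> \<le> 1 * \<rho> i powr (- p)"
      using u[OF i] u_le[OF i] assms by (intro mult_right_mono powr_le1) auto
    finally show "u i ^ m * (1 / (u i * \<rho> i)) powr p \<le> \<rho> i powr (- p)" by simp
  qed
  also have "\<dots> = (\<Sum>i\<in>J. \<rho> i powr (- p) * indicator (cball (z i) (2 * \<rho> i)) x)"
    by (intro sum.cong) (auto simp: J_def)
  also have "\<dots> \<le> (\<Sum>i\<in>I. \<rho> i powr (- p) * indicator (cball (z i) (2 * \<rho> i)) x)"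
    using J assms(1) by (intro sum_mono2) auto
  finally have jensen: "(\<Sum>i\<in>J. u i ^ m * (1 / (u i * \<rho> i))) powr p
    \<le> (\<Sum>i\<in>I. \<rho> i powr (- p) * indicator (cball (z i) (2 * \<rho> i)) x)" .
  have nonneg: "0 \<le> (\<Sum>i\<in>J. u i ^ m * (1 / (u i * \<rho> i)))"
    using u \<rho> by (intro sum_nonneg) (auto simp: less_imp_le)
  have "(\<Sum>i\<in>I. u i ^ (m - 1) * norm (grad_bump (z i) (\<rho> i) x)) powr p
      \<le> (8 * exp (1 / 3) * (\<Sum>i\<in>J. u i ^ m * (1 / (u i * \<rho> i)))) powr p"
    using le assms by (intro powr_mono2) (auto intro!: sum_nonneg simp: u_def bump_nonneg)
  also have "\<dots> = (8 * exp (1 / 3)) powr p * (\<Sum>i\<in>J. u i ^ m * (1 / (u i * \<rho> i))) powr p"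
    using nonneg by (simp only: powr_mult mult_nonneg_nonneg exp_ge_zero zero_le_numeral)
  also have "\<dots> \<le> (8 * exp (1 / 3)) powr p * (\<Sum>i\<in>I. \<rho> i powr (- p) * indicator (cball (z i) (2 * \<rho> i)) x)"
    by (intro mult_left_mono jensen) auto
  finally show ?thesis by (simp add: u_def)
qed

text \<open>
  A bump function for the ball \<open>ball y r\<close> that is set to \<open>0\<close> on the balls \<open>ball (z i) (\<rho> i)\<close> and
  remains large outside their doubles. The energy bound has the form that a pointwise minimum of bumps
  would have, although the function is smooth.
\<close>

definition is_cutoff :: "real \<Rightarrow> real \<Rightarrow> nat set \<Rightarrow> (nat \<Rightarrow> 'a::euclidean_space) \<Rightarrow> (nat \<Rightarrow> real) \<Rightarrow>
    'a \<Rightarrow> real \<Rightarrow> ('a \<Rightarrow> real) \<Rightarrow> bool" where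
  "is_cutoff p K I z \<rho> y r F \<longleftrightarrow> (\<forall>k. C_k k F) \<and>
     (\<forall>x. F x \<noteq> 0 \<longrightarrow> x \<in> cball y (2 * r) - (\<Union>i\<in>I. ball (z i) (\<rho> i))) \<and>
     (\<forall>x\<in>ball y r - (\<Union>i\<in>I. cball (z i) (2 * \<rho> i)). F x \<ge> 1) \<and>
     (\<forall>x. norm (grad F x) powr p \<le> K * (r powr (- p) * indicator (cball y (2 * r)) x +
        (\<Sum>i\<in>I. \<rho> i powr (- p) * indicator (cball (z i) (2 * \<rho> i)) x)))"

text \<open>
  The cutoff is \<open>u \<cdot> \<phi>(S)\<close>, where \<open>u\<close> is the bump for \<open>ball y r\<close>, \<open>S = \<Sum> u\<^sub>i\<^sup>m\<close> is built from the bumps of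
  the small balls, and \<open>\<phi>\<close> decreases smoothly from \<open>\<phi>(0) = 1\<close> to \<open>\<phi>(S) = 0\<close> for \<open>S \<ge> 1\<close>. On a small ball
  \<open>S \<ge> 1\<close>, so the cutoff vanishes; its gradient involves \<open>\<nabla>S\<close> only where \<open>S < 1\<close>, and there
  \<open>sum_bump_gradients_le\<close> applies. The constant \<open>K\<close> depends on \<open>p\<close> only, not on the number of balls.
\<close>

lemma exists_cutoff:
  fixes p :: real
  assumes "p \<ge> 1"
  shows "\<exists>K>0. \<forall>(I::nat set) z \<rho> (y::'a::euclidean_space) r.
    finite I \<longrightarrow> (\<forall>i\<in>I. \<rho> i > 0) \<longrightarrow> r > 0 \<longrightarrow>
    (\<exists>F. is_cutoff p K I z \<rho> y r F)"
proof -
  define m where "m = nat \<lceil>p\<rceil>"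
  have m: "real m \<ge> p" "m \<ge> 1" using assms by (auto simp: m_def) linarith
  define L where "L = 8 * exp (1 / 3 :: real)"
  define M where "M = exp (1 / 3) * (2 * exp 1) * real m"
  have pos: "L > 0" "M > 0" using m by (auto simp: L_def M_def)
  define K where "K = 2 powr p * (M powr p * L powr p + L powr p)"
  have "K > 0" using pos by (simp add: K_def add_pos_pos)
  have "\<exists>F. is_cutoff p K I z \<rho> y r F"
    if I: "finite I" and \<rho>: "\<forall>i\<in>I. \<rho> i > 0" and r: "r > 0"
    for I :: "nat set" and z \<rho> and y :: 'a and r
  proof -
    define S where "S x = (\<Sum>i\<in>I. bump (z i) (\<rho> i) x ^ m)" for x
    define \<phi> where "\<phi> s = exp 1 * flat_exp 1 (1 - s)" for s
    define \<phi>' where "\<phi>' s = - exp 1 * flat_exp (monom 1 2) (1 - s)" for s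
    define F where "F x = bump y r x * \<phi> (S x)" for x
    define dS where "dS x = (\<Sum>i\<in>I. (real m * bump (z i) (\<rho> i) x ^ (m - 1)) *\<^sub>R grad_bump (z i) (\<rho> i) x)" for x
    have S_nonneg: "S x \<ge> 0" for x
      by (simp add: S_def sum_nonneg bump_nonneg)
    have \<phi>_le: "\<phi> s \<le> 1" if "s \<ge> 0" for s
    proof (cases "s < 1")
      case True
      then have "1 \<le> 1 / (1 - s)" using that by simp
      then have "exp 1 * exp (- (1 / (1 - s))) \<le> 1"
        by (simp flip: exp_add)
      then show ?thesis using True by (simp add: \<phi>_def flat_exp_def)
    qed (auto simp: \<phi>_def flat_exp_def)
    have \<phi>_nonneg: "\<phi> s \<ge> 0" for s
      by (simp add: \<phi>_def flat_exp_one_nonneg)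
    have \<phi>_zero: "\<phi> s = 0" "\<phi>' s = 0" if "s \<ge> 1" for s
      using that by (auto simp: \<phi>_def \<phi>'_def flat_exp_def)
    have \<phi>'_le: "\<bar>\<phi>' s\<bar> \<le> 2 * exp 1" for s
      using flat_exp_deriv_le_2[of "1 - s"] by (simp add: \<phi>'_def abs_mult flat_exp_deriv_nonneg)
    have D\<phi>: "(\<phi> has_real_derivative \<phi>' s) (at s)" for s
      unfolding \<phi>_def \<phi>'_def
      by (auto intro!: derivative_eq_intros DERIV_chain'[OF _ flat_exp_one_has_derivative])
    have "GDERIV S x :> dS x" for x
      unfolding S_def[abs_def] dS_def
    proof (rule GDERIV_sum)
      fix i
      show "GDERIV (\<lambda>x. bump (z i) (\<rho> i) x ^ m) x :>
          (real m * bump (z i) (\<rho> i) x ^ (m - 1)) *\<^sub>R grad_bump (z i) (\<rho> i) x"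
        by (rule GDERIV_DERIV_compose[OF GDERIV_bump]) (auto intro!: derivative_eq_intros)
    qed
    from GDERIV_mult[OF GDERIV_bump GDERIV_DERIV_compose[OF this D\<phi>]]
    have grad_F: "grad F x = bump y r x *\<^sub>R (\<phi>' (S x) *\<^sub>R dS x) + \<phi> (S x) *\<^sub>R grad_bump y r x" for x
      unfolding F_def[abs_def] by (intro grad_eq)
    have smooth: "C_k k F" for k
    proof -
      have "C_k k (\<lambda>x. bump y r x * (exp 1 * flat_exp 1 (1 + (- 1) * (\<Sum>i\<in>I. bump (z i) (\<rho> i) x ^ m))))"
        by (intro C_k_mult C_k_bump C_k_const C_k_flat_exp C_k_add C_k_sum C_k_power)
      then show ?thesis by (simp add: F_def[abs_def] \<phi>_def S_def)
    qed
    have support: "x \<in> cball y (2 * r) - (\<Union>i\<in>I. ball (z i) (\<rho> i))" if "F x \<noteq> 0" for x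
    proof -
      have "bump y r x > 0" using that bump_nonneg[of y r x] by (auto simp: F_def less_le)
      then have "x \<in> cball y (2 * r)" using bump_pos_iff[OF r, of y x] by auto
      moreover have False if i: "i \<in> I" "x \<in> ball (z i) (\<rho> i)" for i
      proof -
        have "1 \<le> bump (z i) (\<rho> i) x ^ m"
          using bump_ge_1 i \<rho> by (intro one_le_power) auto
        also have "\<dots> \<le> S x"
          unfolding S_def using i I by (intro member_le_sum) (auto simp: bump_nonneg)
        finally show False using \<open>F x \<noteq> 0\<close> \<phi>_zero by (simp add: F_def)
      qed
      ultimately show ?thesis by blast
    qed
    have one: "F x \<ge> 1" if "x \<in> ball y r - (\<Union>i\<in>I. cball (z i) (2 * \<rho> i))" for x
    proof -
      have "bump (z i) (\<rho> i) x = 0" if "i \<in> I" for i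
      proof -
        have "x \<notin> ball (z i) (2 * \<rho> i)"
          using \<open>x \<in> ball y r - _\<close> that by force
        then show ?thesis
          using bump_pos_iff[of "\<rho> i" "z i" x] bump_nonneg[of "z i" "\<rho> i" x] that \<rho> by auto
      qed
      then have "S x = 0" using m by (simp add: S_def)
      moreover have "\<phi> 0 = 1" by (simp add: \<phi>_def flat_exp_def flip: exp_add)
      ultimately show ?thesis using bump_ge_1[OF r, of x y] that by (simp add: F_def)
    qed
    have bound: "norm (grad F x) powr p \<le> K * (r powr (- p) * indicator (cball y (2 * r)) x +
         (\<Sum>i\<in>I. \<rho> i powr (- p) * indicator (cball (z i) (2 * \<rho> i)) x))" for x
    proof -
      define \<Sigma> where "\<Sigma> = (\<Sum>i\<in>I. \<rho> i powr (- p) * indicator (cball (z i) (2 * \<rho> i)) x)"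
      have "\<Sigma> \<ge> 0" by (simp add: \<Sigma>_def sum_nonneg)
      define T where "T = (\<Sum>i\<in>I. bump (z i) (\<rho> i) x ^ (m - 1) * norm (grad_bump (z i) (\<rho> i) x))"
      have "T \<ge> 0" by (simp add: T_def sum_nonneg bump_nonneg)
      have "norm (dS x) \<le> (\<Sum>i\<in>I. norm ((real m * bump (z i) (\<rho> i) x ^ (m - 1)) *\<^sub>R grad_bump (z i) (\<rho> i) x))"
        unfolding dS_def by (rule norm_sum)
      also have "\<dots> = real m * T"
        by (simp add: T_def sum_distrib_left abs_mult bump_nonneg mult.assoc)
      finally have dS: "norm (dS x) \<le> real m * T" .
      have A: "norm (bump y r x *\<^sub>R (\<phi>' (S x) *\<^sub>R dS x)) powr p \<le> M powr p * (L powr p * \<Sigma>)"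
      proof (cases "S x \<ge> 1")
        case True
        then show ?thesis using \<phi>_zero \<open>\<Sigma> \<ge> 0\<close> by simp
      next
        case False
        have T_powr: "T powr p \<le> L powr p * \<Sigma>"
          unfolding T_def L_def \<Sigma>_def using I \<rho> assms m False
          by (intro sum_bump_gradients_le) (auto simp: S_def)
        have "norm (bump y r x *\<^sub>R (\<phi>' (S x) *\<^sub>R dS x)) = bump y r x * (\<bar>\<phi>' (S x)\<bar> * norm (dS x))"
          by (simp add: abs_mult bump_nonneg)
        also have "\<dots> \<le> exp (1 / 3) * (2 * exp 1 * (real m * T))"
          using \<open>T \<ge> 0\<close> by (intro mult_mono bump_le \<phi>'_le dS) auto
        also have "\<dots> = M * T" by (simp add: M_def)
        finally have "norm (bump y r x *\<^sub>R (\<phi>' (S x) *\<^sub>R dS x)) powr p \<le> (M * T) powr p"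
          using assms by (intro powr_mono2) auto
        also have "\<dots> = M powr p * T powr p"
          using pos \<open>T \<ge> 0\<close> by (simp add: powr_mult)
        also have "\<dots> \<le> M powr p * (L powr p * \<Sigma>)"
          by (intro mult_left_mono T_powr) auto
        finally show ?thesis .
      qed
      have B: "norm (\<phi> (S x) *\<^sub>R grad_bump y r x) powr p \<le> L powr p * (r powr (- p) * indicator (cball y (2 * r)) x)"
      proof (cases "x \<in> cball y (2 * r)")
        case True
        have "norm (\<phi> (S x) *\<^sub>R grad_bump y r x) = \<phi> (S x) * norm (grad_bump y r x)"
          by (simp add: \<phi>_nonneg)
        also have "\<dots> \<le> 1 * (L / r)"
          unfolding L_def using r
          by (intro mult_mono \<phi>_le norm_grad_bump_le S_nonneg) auto
        finally have "norm (\<phi> (S x) *\<^sub>R grad_bump y r x) powr p \<le> (L / r) powr p"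
          using assms by (intro powr_mono2) auto
        also have "\<dots> = L powr p * r powr (- p)"
          using r pos by (simp add: powr_divide powr_minus_divide)
        finally show ?thesis using True by simp
      next
        case False
        then have "grad_bump y r x = 0" using grad_bump_outside[OF r, of x y] by auto
        then show ?thesis by simp
      qed
      have "norm (grad F x) powr p \<le>
          (norm (bump y r x *\<^sub>R (\<phi>' (S x) *\<^sub>R dS x)) + norm (\<phi> (S x) *\<^sub>R grad_bump y r x)) powr p"
        unfolding grad_F using assms by (intro powr_mono2 norm_triangle_ineq) auto
      also have "\<dots> \<le> 2 powr p * (norm (bump y r x *\<^sub>R (\<phi>' (S x) *\<^sub>R dS x)) powr p
          + norm (\<phi> (S x) *\<^sub>R grad_bump y r x) powr p)"
        using assms by (intro powr_add_le) auto
      also have "\<dots> \<le> 2 powr p * (M powr p * (L powr p * \<Sigma>)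
          + L powr p * (r powr (- p) * indicator (cball y (2 * r)) x))"
        by (intro mult_left_mono add_mono A B) auto
      also have "\<dots> \<le> K * (r powr (- p) * indicator (cball y (2 * r)) x + \<Sigma>)"
        using \<open>\<Sigma> \<ge> 0\<close> by (simp add: K_def algebra_simps)
      finally show ?thesis by (simp add: \<Sigma>_def)
    qed
    show ?thesis
      unfolding is_cutoff_def using smooth support one bound by (intro exI[of _ F]) blast
  qed
  then show ?thesis using \<open>K > 0\<close> by blast
qed


section \<open>Covers of sets of small Hausdorff dimension\<close>

text \<open>
  Below the exponent \<open>s\<close> there is some \<open>s'\<close> with vanishing Hausdorff measure, and for sets of diameter
  at most \<open>1\<close> the \<open>s\<close>-th power of the diameter is at most the \<open>s'\<close>-th. Each covering set that meets
  \<open>E\<close> is put into a ball centred in \<open>E\<close>; compactness leaves finitely many of these balls. The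
  bound on the sum also makes the radii small, because each \<open>\<rho> i powr s\<close> is below \<open>\<epsilon>\<close>.
\<close>

lemma hausdorff_dim_less_imp_small_cover:
  fixes E :: "'a::metric_space set"
  assumes "compact E" and dim: "hausdorff_dim E < ereal s" and "\<epsilon> > 0"
  shows "\<exists>(I::nat set) z \<rho>. finite I \<and> (\<forall>i\<in>I. z i \<in> E \<and> \<rho> i > 0) \<and>
    E \<subseteq> (\<Union>i\<in>I. ball (z i) (\<rho> i)) \<and> (\<Sum>i\<in>I. \<rho> i powr s) < \<epsilon>"
proof -
  obtain s' where s': "0 \<le> s'" "s' < s" "hausdorff_measure s' E = 0"
    using dim unfolding hausdorff_dim_def Inf_less_iff by auto
  \<comment> \<open>the diameters will be doubled, and enlarging degenerate sets adds up to \<open>2\<epsilon>'\<close>\<close>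
  define \<epsilon>' where "\<epsilon>' = \<epsilon> / (2 powr s + 2)"
  have "2 powr s + 2 > 0" by (simp add: add_nonneg_pos)
  then have "\<epsilon>' > 0" and \<epsilon>': "(2 powr s + 2) * \<epsilon>' = \<epsilon>"
    using \<open>\<epsilon> > 0\<close> by (auto simp: \<epsilon>'_def)
  have "hausdorff_premeasure s' 1 E \<le> hausdorff_measure s' E"
    unfolding hausdorff_measure_def by (intro SUP_upper) auto
  then have "hausdorff_premeasure s' 1 E < ennreal \<epsilon>'"
    using s' \<open>\<epsilon>' > 0\<close> by simp
  then obtain U :: "nat \<Rightarrow> 'a set" where U: "E \<subseteq> (\<Union>i. U i)"
    "\<And>i. bounded (U i)" "\<And>i. diameter (U i) \<le> 1" "(\<Sum>i. diameter_powr (U i) s') < ennreal \<epsilon>'"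
    unfolding hausdorff_premeasure_def Inf_less_iff by auto
  define d where "d i = (if U i \<inter> E = {} then 0 else diameter (U i))" for i
  have d_nonneg: "0 \<le> d i" for i
    using U(2) by (auto simp: d_def diameter_ge_0)
  have d_le: "ennreal (d i powr s) \<le> diameter_powr (U i) s'" for i
  proof (cases "U i \<inter> E = {}")
    case False
    have "diameter (U i) powr s \<le> diameter (U i) powr s'" if "s' \<noteq> 0"
    proof (cases "diameter (U i) = 0")
      case False
      then show ?thesis
        using U(2,3)[of i] s' diameter_ge_0[of "U i"] by (intro powr_mono') auto
    qed auto
    moreover have "diameter (U i) powr s \<le> 1"
      using U(2,3)[of i] s' diameter_ge_0[of "U i"] by (intro powr_le1) auto
    ultimately show ?thesis
      using False by (auto simp: d_def diameter_powr_def intro!: ennreal_leI)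
  qed (auto simp: d_def)
  \<comment> \<open>a set of diameter \<open>0\<close> still needs a ball of positive radius\<close>
  define \<tau> where "\<tau> i = (\<epsilon>' * (1 / 2) ^ i) powr (1 / s)" for i :: nat
  have \<tau>_pos: "\<tau> i > 0" and \<tau>_powr: "\<tau> i powr s = \<epsilon>' * (1 / 2) ^ i" for i
    using \<open>\<epsilon>' > 0\<close> s' by (auto simp: \<tau>_def powr_powr)
  define \<rho> where "\<rho> i = max (2 * d i) (\<tau> i)" for i
  have \<rho>_pos: "\<rho> i > 0" for i
    using \<tau>_pos by (auto simp: \<rho>_def less_max_iff_disj)
  have d_less: "d i < \<rho> i" for i
    using \<tau>_pos[of i] d_nonneg[of i] by (auto simp: \<rho>_def less_max_iff_disj)
  have \<rho>_powr: "\<rho> i powr s \<le> 2 powr s * d i powr s + \<epsilon>' * (1 / 2) ^ i" for i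
  proof -
    have "\<rho> i powr s = max ((2 * d i) powr s) (\<tau> i powr s)"
      using s' d_nonneg[of i] \<tau>_pos[of i]
      by (auto simp: \<rho>_def max_def powr_mono2 intro!: antisym powr_mono2)
    also have "\<dots> \<le> (2 * d i) powr s + \<tau> i powr s" by auto
    finally show ?thesis
      using d_nonneg[of i] by (simp add: powr_mult \<tau>_powr)
  qed
  define z where "z i = (SOME x. x \<in> U i \<inter> E)" for i
  have z: "z i \<in> U i \<inter> E" if "U i \<inter> E \<noteq> {}" for i
    using that unfolding z_def by (metis some_in_eq)
  define A where "A = {i. U i \<inter> E \<noteq> {}}"
  have cover: "E \<subseteq> (\<Union>i\<in>A. ball (z i) (\<rho> i))"
  proof
    fix x assume "x \<in> E"
    then obtain i where i: "x \<in> U i" using U(1) by auto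
    then have A: "i \<in> A" using \<open>x \<in> E\<close> by (auto simp: A_def)
    then have "dist (z i) x \<le> d i"
      using diameter_bounded_bound[OF U(2), of "z i" i x] z[of i] i
      by (auto simp: A_def d_def)
    then show "x \<in> (\<Union>i\<in>A. ball (z i) (\<rho> i))"
      using d_less[of i] A by force
  qed
  obtain I where I: "I \<subseteq> A" "finite I" "E \<subseteq> (\<Union>i\<in>I. ball (z i) (\<rho> i))"
    by (rule compactE_image[OF \<open>compact E\<close> _ cover]) auto
  have "ennreal (\<Sum>i\<in>I. d i powr s) = (\<Sum>i\<in>I. ennreal (d i powr s))"
    by simp
  also have "\<dots> \<le> (\<Sum>i\<in>I. diameter_powr (U i) s')"
    by (intro sum_mono d_le)
  also have "\<dots> \<le> (\<Sum>i. diameter_powr (U i) s')"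
    using I by (intro sum_le_suminf) auto
  also have "\<dots> < ennreal \<epsilon>'" by (rule U)
  finally have sum_d: "(\<Sum>i\<in>I. d i powr s) < \<epsilon>'"
    using \<open>\<epsilon>' > 0\<close> by (simp add: ennreal_less_iff sum_nonneg)
  have "(\<Sum>i\<in>I. (1 / 2 :: real) ^ i) \<le> (\<Sum>i. (1 / 2) ^ i)"
    using I by (intro sum_le_suminf summable_geometric) auto
  then have sum_half: "(\<Sum>i\<in>I. (1 / 2 :: real) ^ i) \<le> 2"
    by (simp add: suminf_geometric)
  have "(\<Sum>i\<in>I. \<rho> i powr s) \<le> (\<Sum>i\<in>I. 2 powr s * d i powr s + \<epsilon>' * (1 / 2) ^ i)"
    by (intro sum_mono \<rho>_powr)
  also have "\<dots> = 2 powr s * (\<Sum>i\<in>I. d i powr s) + \<epsilon>' * (\<Sum>i\<in>I. (1 / 2) ^ i)"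
    by (simp add: sum.distrib sum_distrib_left)
  also have "\<dots> < 2 powr s * \<epsilon>' + \<epsilon>' * 2"
    using sum_d sum_half \<open>\<epsilon>' > 0\<close> by (intro add_less_le_mono mult_strict_left_mono mult_left_mono) auto
  also have "\<dots> = \<epsilon>" using \<epsilon>' by (simp add: algebra_simps)
  finally show ?thesis
    using I z \<rho>_pos by (intro exI[of _ I] exI[of _ z] exI[of _ \<rho>]) (auto simp: A_def)
qed

lemma null_if_hausdorff_dim_less:
  fixes E :: "'a::euclidean_space set"
  assumes "compact E" and dim: "hausdorff_dim E < ereal s" and s: "0 < s" "s \<le> DIM('a)"
  shows "emeasure lborel E = 0"
proof -
  have "emeasure lborel E \<le> ennreal (unit_ball_vol (DIM('a)) * \<epsilon>)" if "0 < \<epsilon>" "\<epsilon> < 1" for \<epsilon>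
  proof -
    obtain I :: "nat set" and z \<rho> where I: "finite I" "\<And>i. i \<in> I \<Longrightarrow> \<rho> i > 0"
      "E \<subseteq> (\<Union>i\<in>I. ball (z i) (\<rho> i))" "(\<Sum>i\<in>I. \<rho> i powr s) < \<epsilon>"
      using hausdorff_dim_less_imp_small_cover[OF \<open>compact E\<close> dim \<open>0 < \<epsilon>\<close>] by blast
    have le: "\<rho> i ^ DIM('a) \<le> \<rho> i powr s" if "i \<in> I" for i
    proof -
      have "\<rho> i powr s \<le> (\<Sum>i\<in>I. \<rho> i powr s)"
        using I(1) that by (intro member_le_sum) auto
      then have "\<rho> i powr s < 1 powr s" using I(4) \<open>\<epsilon> < 1\<close> by simp
      then have "\<rho> i < 1" using powr_less_cancel2[of s "\<rho> i" 1] s I(2)[OF that] by auto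
      then have "\<rho> i powr real (DIM('a)) \<le> \<rho> i powr s"
        using I(2)[OF that] s by (intro powr_mono') auto
      then show ?thesis using I(2)[OF that] by (simp add: powr_realpow)
    qed
    have "emeasure lborel E \<le> emeasure lborel (\<Union>i\<in>I. ball (z i) (\<rho> i))"
      using I by (intro emeasure_mono) auto
    also have "\<dots> \<le> (\<Sum>i\<in>I. emeasure lborel (ball (z i) (\<rho> i)))"
      using I by (intro emeasure_subadditive_finite) auto
    also have "\<dots> = (\<Sum>i\<in>I. ennreal (unit_ball_vol (DIM('a)) * \<rho> i ^ DIM('a)))"
      using I by (intro sum.cong) (auto simp: emeasure_ball less_imp_le)
    also have "\<dots> \<le> (\<Sum>i\<in>I. ennreal (unit_ball_vol (DIM('a)) * \<rho> i powr s))"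
      using le by (intro sum_mono ennreal_leI mult_left_mono) auto
    also have "\<dots> = ennreal (unit_ball_vol (DIM('a)) * (\<Sum>i\<in>I. \<rho> i powr s))"
      by (simp add: sum_distrib_left)
    also have "\<dots> \<le> ennreal (unit_ball_vol (DIM('a)) * \<epsilon>)"
      using I by (intro ennreal_leI mult_left_mono) auto
    finally show ?thesis .
  qed
  note small = this
  show ?thesis
  proof (rule ccontr)
    assume "emeasure lborel E \<noteq> 0"
    moreover have "emeasure lborel E < \<infinity>"
      using \<open>compact E\<close> by (intro emeasure_bounded_finite compact_imp_bounded)
    ultimately obtain c where c: "emeasure lborel E = ennreal c" "c > 0"
      by (cases "emeasure lborel E") (auto simp: less_le)
    let ?w = "unit_ball_vol (DIM('a))"
    define \<epsilon> where "\<epsilon> = min (1 / 2) (c / (2 * ?w))"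
    have "?w > 0" by simp
    then have "0 < \<epsilon>" "\<epsilon> < 1" using c by (auto simp: \<epsilon>_def min_def)
    have "?w * \<epsilon> \<le> ?w * (c / (2 * ?w))"
      using \<open>?w > 0\<close> by (intro mult_left_mono) (auto simp: \<epsilon>_def)
    also have "\<dots> = c / 2" using \<open>?w > 0\<close> by (simp add: less_imp_neq[symmetric])
    finally have "?w * \<epsilon> \<le> c / 2" .
    moreover have "c \<le> ?w * \<epsilon>"
      using small[OF \<open>0 < \<epsilon>\<close> \<open>\<epsilon> < 1\<close>] mult_pos_pos[OF \<open>?w > 0\<close> \<open>0 < \<epsilon>\<close>]
      unfolding c(1) by (subst (asm) ennreal_le_iff) auto
    ultimately show False using c by simp
  qed
qed


section \<open>Separated sets and the Assouad dimension\<close>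

text \<open>
  Maximal separated subsets replace minimal covers in all counting arguments: they are covers with
  centres in the set, as the definition of the covering number requires, and disjoint balls around
  their points can be compared with measures.
\<close>

abbreviation separated :: "real \<Rightarrow> 'a::metric_space set \<Rightarrow> bool" where
  "separated t \<equiv> pairwise (\<lambda>x y. t \<le> dist x y)"

lemma separated_imp_disjoint_balls:
  assumes "separated t S" "x \<in> S" "y \<in> S" "x \<noteq> y"
  shows "ball x (t / 2) \<inter> ball y (t / 2) = {}"
proof -
  have "t \<le> dist x y" using assms by (auto simp: pairwise_def)
  then show ?thesis by (intro disjoint_ballI) auto
qed

lemma separated_card_le_1:
  assumes "separated t S" "S \<subseteq> ball y \<rho>" "\<rho> \<le> t / 2"
  shows "card S \<le> 1"
proof -
  have "x = z" if "x \<in> S" "z \<in> S" for x z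
  proof (rule ccontr)
    assume "x \<noteq> z"
    then have "t \<le> dist x z" using that assms by (auto simp: pairwise_def)
    moreover have "dist x z < \<rho> + \<rho>"
      using that assms(2) by (intro le_less_trans[OF dist_triangle3[of x z y]] add_strict_mono) auto
    ultimately show False using assms(3) by simp
  qed
  then show ?thesis by (cases "finite S") (auto simp: card_le_Suc0_iff_eq)
qed

lemma separated_card_volume_bound:
  fixes S :: "'a::euclidean_space set"
  assumes "finite S" "separated t S" "S \<subseteq> cball y R" "t > 0" "R \<ge> 0"
  shows "real (card S) * (t / 2) ^ DIM('a) \<le> (R + t / 2) ^ DIM('a)"
proof -
  let ?w = "unit_ball_vol (real DIM('a))"
  have "(\<Sum>x\<in>S. emeasure lborel (ball x (t / 2))) = emeasure lborel (\<Union>x\<in>S. ball x (t / 2))"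
    using assms separated_imp_disjoint_balls[OF assms(2)]
    by (intro sum_emeasure) (auto simp: disjoint_family_on_def)
  also have "\<dots> \<le> emeasure lborel (ball y (R + t / 2))"
  proof (intro emeasure_mono subsetI)
    fix x assume "x \<in> (\<Union>x\<in>S. ball x (t / 2))"
    then obtain z where "z \<in> S" "dist z x < t / 2" by auto
    then have "dist y z \<le> R" using assms(3) by auto
    then show "x \<in> ball y (R + t / 2)"
      using \<open>dist z x < t / 2\<close> dist_triangle[of y x z] by simp
  qed auto
  finally have "ennreal (real (card S) * (?w * (t / 2) ^ DIM('a))) \<le> ennreal (?w * (R + t / 2) ^ DIM('a))"
    using assms by (simp add: emeasure_ball ennreal_mult ennreal_of_nat_eq_real_of_nat)
  then have "?w * (real (card S) * (t / 2) ^ DIM('a)) \<le> ?w * (R + t / 2) ^ DIM('a)"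
    using assms by (subst (asm) ennreal_le_iff) (auto simp: mult_ac)
  then show ?thesis by (subst (asm) mult_le_cancel_left_pos) auto
qed

lemma exists_maximal_separated:
  fixes A :: "'a::euclidean_space set"
  assumes "bounded A" "t > 0"
  shows "\<exists>S. finite S \<and> S \<subseteq> A \<and> separated t S \<and> A \<subseteq> (\<Union>x\<in>S. ball x t)"
proof -
  obtain y R where R: "A \<subseteq> cball y R" "R > 0"
    using assms(1) using bounded_subset_ballD[of A 0] by (metis ball_subset_cball subset_trans)
  define P where "P k \<longleftrightarrow> (\<exists>S. finite S \<and> S \<subseteq> A \<and> separated t S \<and> card S = k)" for k
  define b where "b = nat \<lceil>(R + t / 2) ^ DIM('a) / (t / 2) ^ DIM('a)\<rceil>"
  have "k \<le> b" if "P k" for k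
  proof -
    obtain S where S: "finite S" "S \<subseteq> A" "separated t S" "card S = k"
      using \<open>P k\<close> by (auto simp: P_def)
    then have "real k * (t / 2) ^ DIM('a) \<le> (R + t / 2) ^ DIM('a)"
      using separated_card_volume_bound[of S t y R] R assms by auto
    then have "real k \<le> (R + t / 2) ^ DIM('a) / (t / 2) ^ DIM('a)"
      using assms by (simp add: field_simps)
    then show ?thesis unfolding b_def by linarith
  qed
  moreover have "P 0" unfolding P_def by (intro exI[of _ "{}"]) auto
  ultimately obtain k where k: "P k" "\<And>j. P j \<Longrightarrow> j \<le> k"
    using Nat.ex_has_greatest_nat[of P 0 b] by auto
  obtain S where S: "finite S" "S \<subseteq> A" "separated t S" "card S = k"
    using k(1) by (auto simp: P_def)
  have "x \<in> (\<Union>x\<in>S. ball x t)" if "x \<in> A" for x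
  proof (rule ccontr)
    assume *: "x \<notin> (\<Union>x\<in>S. ball x t)"
    then have "x \<notin> S" using \<open>t > 0\<close> by auto
    have "separated t (insert x S)"
      using S(3) * by (auto simp: pairwise_insert not_less dist_commute)
    then have "P (Suc k)"
      unfolding P_def using S that \<open>x \<notin> S\<close> by (intro exI[of _ "insert x S"]) auto
    then show False using k(2) by force
  qed
  then show ?thesis using S by blast
qed

text \<open>
  It is enough to count separated points, since a maximal separated subset is an admissible cover.
\<close>

lemma assouad_dim_le:
  fixes E :: "'a::euclidean_space set"
  assumes "bounded E" "l \<ge> 0" "C > 0"
    and card: "\<And>x t R S. x \<in> E \<Longrightarrow> 0 < t \<Longrightarrow> t < R \<Longrightarrow> finite S \<Longrightarrow> S \<subseteq> E \<inter> ball x R \<Longrightarrow>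
      separated t S \<Longrightarrow> real (card S) \<le> C * (R / t) powr l"
  shows "assouad_dim E \<le> ereal l"
  unfolding assouad_dim_def
proof (intro Inf_lower CollectI exI conjI refl ballI allI impI)
  fix x r R assume x: "x \<in> E" and "0 < r \<and> r < R \<and> (bounded E \<longrightarrow> R < diameter E)"
  then have r: "0 < r" "r < R" by auto
  obtain S where S: "finite S" "S \<subseteq> E \<inter> ball x R" "separated r S"
      "E \<inter> ball x R \<subseteq> (\<Union>x\<in>S. ball x r)"
    using exists_maximal_separated[of "E \<inter> ball x R" r] assms(1) r by auto
  have "covering_number (E \<inter> ball x R) r \<le> card S"
    unfolding covering_number_def using S by (intro Least_le exI[of _ S]) auto
  then have "real (covering_number (E \<inter> ball x R) r) \<le> C * (R / r) powr l"
    using card[OF x r S(1-3)] by linarith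
  also have "(R / r) powr l = (r / R) powr (- l)"
    using r by (simp add: powr_minus powr_divide)
  finally show "real (covering_number (E \<inter> ball x R) r) \<le> C * (r / R) powr (- l)" .
qed (use assms in auto)

text \<open>
  The balls of radius \<open>t/2\<close> around \<open>t\<close>-separated points of \<open>ball x R\<close> are disjoint and contained in a
  ball of radius less than \<open>2R\<close>; compare volumes.
\<close>

lemma assouad_dim_le_DIM:
  fixes E :: "'a::euclidean_space set"
  assumes "bounded E"
  shows "assouad_dim E \<le> ereal (DIM('a))"
proof (rule assouad_dim_le[OF assms, where C = "4 ^ DIM('a)"])
  fix x :: 'a and t R :: real and S
  assume *: "0 < t" "t < R" "finite S" "S \<subseteq> E \<inter> ball x R" "separated t S"
  then have "real (card S) * (t / 2) ^ DIM('a) \<le> (R + t / 2) ^ DIM('a)"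
    by (intro separated_card_volume_bound[where y = x]) (auto intro: less_imp_le)
  also have "\<dots> \<le> (2 * R) ^ DIM('a)"
    using * by (intro power_mono) auto
  also have "2 * R = 4 * (R / t) * (t / 2)"
    using * by simp
  also have "\<dots> ^ DIM('a) = 4 ^ DIM('a) * (R / t) ^ DIM('a) * (t / 2) ^ DIM('a)"
    by (simp only: power_mult_distrib)
  finally show "real (card S) \<le> 4 ^ DIM('a) * (R / t) powr real DIM('a)"
    using * by (simp add: powr_realpow)
qed auto


section \<open>Self-improvement of the Aikawa condition\<close>

text \<open>
  The density vanishes on \<open>H\<close>, as \<open>0 powr c = 0\<close>. For \<open>Q < DIM('a)\<close> the natural value there would be
  \<open>\<infinity>\<close>; this makes no difference when \<open>H\<close> is a null set.
\<close>

abbreviation distance_weight :: "'a::euclidean_space set \<Rightarrow> real \<Rightarrow> 'a measure" where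
  "distance_weight H Q \<equiv> density lborel (\<lambda>x. ennreal (infdist x H powr (Q - real DIM('a))))"

lemma borel_measurable_infdist_powr [measurable]:
  "(\<lambda>x. infdist x H powr c) \<in> borel_measurable (borel :: 'a::metric_space measure)"
proof -
  have [measurable]: "(\<lambda>x::'a. infdist x H) \<in> borel_measurable borel"
    by (intro borel_measurable_continuous_onI continuous_intros)
  show ?thesis by measurable
qed

lemma distance_weight_ge:
  fixes H :: "'a::euclidean_space set" and Q :: real
  assumes "A \<in> sets borel" "c \<ge> 0" "\<And>x. x \<in> A \<Longrightarrow> c \<le> infdist x H powr (Q - real DIM('a))"
  shows "ennreal c * emeasure lborel A \<le> emeasure (distance_weight H Q) A"
proof -
  have "ennreal c * emeasure lborel A = (\<integral>\<^sup>+x. ennreal c * indicator A x \<partial>lborel)"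
    using assms by (simp add: nn_integral_cmult_indicator)
  also have "\<dots> \<le> (\<integral>\<^sup>+x. ennreal (infdist x H powr (Q - real DIM('a))) * indicator A x \<partial>lborel)"
    using assms by (intro nn_integral_mono) (auto simp: indicator_def intro!: ennreal_leI)
  also have "\<dots> = emeasure (distance_weight H Q) A"
    using assms by (subst emeasure_density) auto
  finally show ?thesis .
qed

lemma borel_shell: "{x \<in> ball z \<sigma>. c \<le> infdist x H} \<in> sets borel"
proof -
  have "closed {x. c \<le> infdist x H}"
    by (intro closed_Collect_le continuous_intros)
  moreover have "{x \<in> ball z \<sigma>. c \<le> infdist x H} = ball z \<sigma> \<inter> {x. c \<le> infdist x H}" by auto
  ultimately show ?thesis by simp
qed

text \<open>
  The Aikawa condition at the points of \<open>E \<subseteq> H\<close> up to the scale \<open>r\<^sub>0\<close>, for the distance to the larger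
  set \<open>H\<close>. Since the density is \<open>0\<close> rather than \<open>\<infinity>\<close> on \<open>H\<close>, the fact that \<open>H\<close> is null near \<open>E\<close>
  does not follow from the integral bound and is part of the definition.
\<close>

definition Aikawa_condition ::
    "'a::euclidean_space set \<Rightarrow> 'a set \<Rightarrow> real \<Rightarrow> real \<Rightarrow> real \<Rightarrow> bool" where
  "Aikawa_condition H E Q r\<^sub>0 C \<longleftrightarrow> (\<forall>y\<in>E. \<forall>r. 0 < r \<and> r \<le> r\<^sub>0 \<longrightarrow>
     emeasure lborel (ball y r \<inter> H) = 0 \<and>
     emeasure (distance_weight H Q) (ball y r) \<le> ennreal (C * r powr Q))"

text \<open>
  The part of \<open>ball z \<sigma>\<close> where the distance \<open>d\<close> to \<open>H\<close> is less than \<open>\<eta> \<sigma>\<close> carries a weight of at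
  least \<open>(\<eta> \<sigma>)\<^bsup>Q-n\<^esup>\<close>, as the exponent is negative. The Aikawa condition thus bounds its volume by
  \<open>C \<eta>\<^bsup>n-Q\<^esup> \<sigma>\<^sup>n\<close>, which is at most half the volume of the ball for small \<open>\<eta>\<close>. On the other half
  \<open>d \<le> \<sigma>\<close>, as \<open>z \<in> H\<close>, so the weight is at least \<open>\<sigma>\<^bsup>Q-n\<^esup>\<close>.
\<close>

lemma Aikawa_shell:
  fixes H :: "'a::euclidean_space set"
  assumes "closed H" "E \<subseteq> H" and Q: "Q < real DIM('a)" and "C > 0"
    and A: "Aikawa_condition H E Q r\<^sub>0 C"
  shows "\<exists>\<eta>. 0 < \<eta> \<and> \<eta> \<le> 1 / 2 \<and> (\<forall>z\<in>E. \<forall>\<sigma>. 0 < \<sigma> \<and> \<sigma> \<le> r\<^sub>0 \<longrightarrow>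
    ennreal (unit_ball_vol (DIM('a)) / 2 * \<sigma> powr Q)
      \<le> emeasure (distance_weight H Q) {x \<in> ball z \<sigma>. \<eta> * \<sigma> \<le> infdist x H})"
proof -
  define n where "n = real DIM('a)"
  define w where "w = unit_ball_vol n"
  have "w > 0" by (simp add: w_def n_def)
  define \<eta> where "\<eta> = min (1 / 2) ((w / (2 * C)) powr (1 / (n - Q)))"
  have \<eta>: "0 < \<eta>" "\<eta> \<le> 1 / 2" using \<open>w > 0\<close> \<open>C > 0\<close> by (auto simp: \<eta>_def)
  have "\<eta> powr (n - Q) \<le> ((w / (2 * C)) powr (1 / (n - Q))) powr (n - Q)"
    using Q \<eta> by (intro powr_mono2) (auto simp: \<eta>_def n_def)
  also have "\<dots> = w / (2 * C)" using Q \<open>w > 0\<close> \<open>C > 0\<close> by (simp add: powr_powr n_def)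
  finally have \<eta>_powr: "C * \<eta> powr (n - Q) \<le> w / 2"
    using \<open>C > 0\<close> by (simp add: field_simps)
  have "ennreal (w / 2 * \<sigma> powr Q)
      \<le> emeasure (distance_weight H Q) {x \<in> ball z \<sigma>. \<eta> * \<sigma> \<le> infdist x H}"
    if z: "z \<in> E" and \<sigma>: "0 < \<sigma>" "\<sigma> \<le> r\<^sub>0" for z \<sigma>
  proof -
    define low where "low = {x \<in> ball z \<sigma>. x \<notin> H \<and> infdist x H < \<eta> * \<sigma>}"
    define high where "high = {x \<in> ball z \<sigma>. \<eta> * \<sigma> \<le> infdist x H}"
    have H_borel [measurable]: "H \<in> sets borel" using \<open>closed H\<close> by simp
    have [measurable]: "high \<in> sets borel"
      unfolding high_def by (rule borel_shell)
    have "low = ball z \<sigma> - high - H" by (auto simp: low_def high_def)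
    then have [measurable]: "low \<in> sets borel" by simp
    have "H \<noteq> {}" using z \<open>E \<subseteq> H\<close> by auto
    have fin: "emeasure lborel B < \<infinity>" if "B \<subseteq> ball z \<sigma>" for B
      using that by (intro emeasure_bounded_finite bounded_subset[OF bounded_ball])
    have "low \<subseteq> ball z \<sigma>" "high \<subseteq> ball z \<sigma>" by (auto simp: low_def high_def)
    have low_fin: "emeasure lborel low = ennreal (measure lborel low)"
      and high_fin: "emeasure lborel high = ennreal (measure lborel high)"
      using fin[OF \<open>low \<subseteq> ball z \<sigma>\<close>] fin[OF \<open>high \<subseteq> ball z \<sigma>\<close>]
      by (simp_all add: emeasure_eq_ennreal_measure less_top)
    have "ennreal ((\<eta> * \<sigma>) powr (Q - n) * measure lborel low)
        = ennreal ((\<eta> * \<sigma>) powr (Q - n)) * emeasure lborel low"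
      by (simp add: low_fin ennreal_mult)
    also have "\<dots> \<le> emeasure (distance_weight H Q) low"
    proof (rule distance_weight_ge)
      fix x assume "x \<in> low"
      then have "0 < infdist x H" "infdist x H < \<eta> * \<sigma>"
        using infdist_pos_not_in_closed[OF \<open>closed H\<close> \<open>H \<noteq> {}\<close>] by (auto simp: low_def)
      then show "(\<eta> * \<sigma>) powr (Q - n) \<le> infdist x H powr (Q - real DIM('a))"
        unfolding n_def[symmetric] using Q by (intro powr_mono2') (auto simp: n_def)
    qed auto
    also have "\<dots> \<le> emeasure (distance_weight H Q) (ball z \<sigma>)"
      by (intro emeasure_mono) (auto simp: low_def)
    also have "\<dots> \<le> ennreal (C * \<sigma> powr Q)"
      using A z \<sigma> by (auto simp: Aikawa_condition_def)
    finally have "(\<eta> * \<sigma>) powr (Q - n) * measure lborel low \<le> C * \<sigma> powr Q"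
      using \<open>C > 0\<close> by (subst (asm) ennreal_le_iff) auto
    then have "measure lborel low \<le> C * \<sigma> powr Q * (\<eta> * \<sigma>) powr (n - Q)"
      using \<eta> \<sigma> by (simp add: powr_diff field_simps)
    also have "\<dots> = C * \<eta> powr (n - Q) * \<sigma> powr n"
      using \<eta> \<sigma> by (simp add: powr_mult powr_diff)
    also have "\<dots> \<le> w / 2 * \<sigma> powr n"
      by (intro mult_right_mono \<eta>_powr) auto
    finally have low_le: "measure lborel low \<le> w / 2 * \<sigma> powr n" .
    have split_ball: "ball z \<sigma> \<subseteq> low \<union> high \<union> (ball z \<sigma> \<inter> H)"
      by (auto simp: low_def high_def)
    have "ennreal (w * \<sigma> powr n) = emeasure lborel (ball z \<sigma>)"
      using \<sigma> by (simp add: emeasure_ball w_def n_def powr_realpow)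
    also have "\<dots> \<le> emeasure lborel (low \<union> high \<union> (ball z \<sigma> \<inter> H))"
      by (intro emeasure_mono split_ball) auto
    also have "\<dots> \<le> emeasure lborel (low \<union> high) + emeasure lborel (ball z \<sigma> \<inter> H)"
      by (intro emeasure_subadditive) auto
    also have "emeasure lborel (ball z \<sigma> \<inter> H) = 0"
      using A z \<sigma> by (auto simp: Aikawa_condition_def)
    also have "emeasure lborel (low \<union> high) + 0 \<le> emeasure lborel low + emeasure lborel high"
      unfolding add_0_right by (intro emeasure_subadditive) auto
    also have "\<dots> = ennreal (measure lborel low + measure lborel high)"
      by (simp add: low_fin high_fin)
    finally have "w * \<sigma> powr n \<le> measure lborel low + measure lborel high"
      by (subst (asm) ennreal_le_iff) auto
    with low_le have high_ge: "w / 2 * \<sigma> powr n \<le> measure lborel high" by simp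
    have "w / 2 * \<sigma> powr Q = \<sigma> powr (Q - n) * (w / 2 * \<sigma> powr n)"
      using \<sigma> by (simp add: powr_diff)
    also have "ennreal \<dots> \<le> ennreal (\<sigma> powr (Q - n) * measure lborel high)"
      by (intro ennreal_leI mult_left_mono high_ge) auto
    also have "\<dots> = ennreal (\<sigma> powr (Q - n)) * emeasure lborel high"
      by (simp add: high_fin ennreal_mult)
    also have "\<dots> \<le> emeasure (distance_weight H Q) high"
    proof (rule distance_weight_ge)
      fix x assume x: "x \<in> high"
      have "0 < \<eta> * \<sigma>" using \<eta> \<sigma> by simp
      also have "\<dots> \<le> infdist x H" using x by (simp add: high_def)
      finally have "0 < infdist x H" .
      moreover have "infdist x H \<le> \<sigma>"
        using x z \<open>E \<subseteq> H\<close> infdist_le[of z H x] by (auto simp: high_def dist_commute)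
      ultimately show "\<sigma> powr (Q - n) \<le> infdist x H powr (Q - real DIM('a))"
        unfolding n_def[symmetric] using Q by (intro powr_mono2') (auto simp: n_def)
    qed auto
    finally show ?thesis by (simp add: high_def)
  qed
  then show ?thesis
    using \<eta> by (intro exI[of _ \<eta>]) (auto simp: w_def n_def)
qed

text \<open>
  The shells \<open>\<eta> \<sigma> \<le> d < \<sigma>\<close> of the scales \<open>\<sigma> = \<eta>\<^sup>j \<rho> / 2\<close> are disjoint for different \<open>j\<close>, and within one
  scale the balls around separated points are disjoint. So all the contributions of \<open>Aikawa_shell\<close> add
  up inside a single ball of radius \<open>2\<rho>\<close>, whatever the number \<open>N\<close> of scales.
\<close>

lemma Aikawa_multiscale_sum:
  fixes H :: "'a::euclidean_space set"
  assumes "closed H" "E \<subseteq> H" and Q: "Q < real DIM('a)" and "C > 0"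
    and A: "Aikawa_condition H E Q r\<^sub>0 C"
  shows "\<exists>\<eta> D. 0 < \<eta> \<and> \<eta> \<le> 1 / 2 \<and> 0 < D \<and>
    (\<forall>y\<in>E. \<forall>\<rho> N T. 0 < \<rho> \<and> \<rho> \<le> r\<^sub>0 / 2 \<and>
      (\<forall>j\<in>{1..N}. finite (T j) \<and> T j \<subseteq> E \<inter> ball y \<rho> \<and> separated (\<eta> ^ j * \<rho>) (T j)) \<longrightarrow>
      (\<Sum>j\<in>{1..N}. real (card (T j)) * (\<eta> ^ j) powr Q) \<le> D)"
proof -
  let ?\<nu> = "distance_weight H Q"
  define w where "w = unit_ball_vol (real DIM('a))"
  have "w > 0" by (simp add: w_def)
  obtain \<eta> where \<eta>: "0 < \<eta>" "\<eta> \<le> 1 / 2" and shell: "\<And>z \<sigma>. z \<in> E \<Longrightarrow> 0 < \<sigma> \<Longrightarrow> \<sigma> \<le> r\<^sub>0 \<Longrightarrow>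
      ennreal (w / 2 * \<sigma> powr Q) \<le> emeasure ?\<nu> {x \<in> ball z \<sigma>. \<eta> * \<sigma> \<le> infdist x H}"
    using Aikawa_shell[OF assms] unfolding w_def by blast
  \<comment> \<open>\<open>4\<^sup>Q\<close> collects one factor \<open>2\<^sup>Q\<close> from the radius \<open>2\<rho>\<close> and one from the halved radii below\<close>
  define D where "D = 2 * C * 4 powr Q / w"
  have "D > 0" using \<open>w > 0\<close> \<open>C > 0\<close> by (simp add: D_def)
  have sum_le: "(\<Sum>j\<in>{1..N}. real (card (T j)) * (\<eta> ^ j) powr Q) \<le> D"
    if y: "y \<in> E" and \<rho>: "0 < \<rho>" "\<rho> \<le> r\<^sub>0 / 2" and
      T: "\<And>j. j \<in> {1..N} \<Longrightarrow> finite (T j) \<and> T j \<subseteq> E \<inter> ball y \<rho> \<and> separated (\<eta> ^ j * \<rho>) (T j)"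
    for y \<rho> N T
  proof -
    define \<sigma> where "\<sigma> j = \<eta> ^ j * \<rho> / 2" for j
    have \<sigma>_pos: "\<sigma> j > 0" for j using \<eta> \<rho> by (simp add: \<sigma>_def)
    have \<eta>_le: "\<eta> ^ j \<le> 1" for j using \<eta> by (intro power_le_one) auto
    have \<sigma>_le: "\<sigma> j \<le> \<rho>" for j
      using \<eta>_le[of j] \<rho> mult_right_mono[OF \<eta>_le[of j], of \<rho>] unfolding \<sigma>_def by auto
    have \<sigma>_step: "\<sigma> k \<le> \<eta> * \<sigma> j" if "j < k" for j k
    proof -
      have "\<eta> ^ k \<le> \<eta> ^ Suc j" using \<eta> that by (intro power_decreasing) auto
      then show ?thesis using \<rho> mult_right_mono[of "\<eta> ^ k" "\<eta> ^ Suc j" \<rho>] by (simp add: \<sigma>_def)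
    qed
    define I where "I = (SIGMA j:{1..N}. T j)"
    define F where "F i = {x \<in> ball (snd i) (\<sigma> (fst i)). \<eta> * \<sigma> (fst i) \<le> infdist x H}" for i :: "nat \<times> 'a"
    have "finite I" using T by (auto simp: I_def)
    have F_less: "infdist x H < \<sigma> (fst i)" if "i \<in> I" "x \<in> F i" for i x
    proof -
      have "snd i \<in> H" using that T \<open>E \<subseteq> H\<close> by (force simp: I_def)
      then have "infdist x H \<le> dist x (snd i)" by (rule infdist_le)
      then show ?thesis using that by (auto simp: F_def dist_commute)
    qed
    have disj_lt: "F i \<inter> F k = {}" if "i \<in> I" "k \<in> I" "fst i < fst k" for i k
    proof -
      have False if x: "x \<in> F i" "x \<in> F k" for x
        using F_less[OF \<open>k \<in> I\<close> x(2)] \<sigma>_step[OF \<open>fst i < fst k\<close>] x(1) by (auto simp: F_def)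
      then show ?thesis by blast
    qed
    have disj: "disjoint_family_on F I"
      unfolding disjoint_family_on_def
    proof (intro ballI impI)
      fix i k assume ik: "i \<in> I" "k \<in> I" "i \<noteq> k"
      consider "fst i < fst k" | "fst k < fst i" | "fst i = fst k" by linarith
      then show "F i \<inter> F k = {}"
      proof cases
        case 3
        then have "ball (snd i) (\<eta> ^ fst i * \<rho> / 2) \<inter> ball (snd k) (\<eta> ^ fst i * \<rho> / 2) = {}"
          using ik T by (intro separated_imp_disjoint_balls[of _ "T (fst i)"]) (auto simp: I_def prod_eq_iff)
        then show ?thesis using 3 by (auto simp: F_def \<sigma>_def)
      qed (use disj_lt ik in blast)+
    qed
    have "ennreal (\<Sum>i\<in>I. w / 2 * \<sigma> (fst i) powr Q) = (\<Sum>i\<in>I. ennreal (w / 2 * \<sigma> (fst i) powr Q))"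
      using \<open>w > 0\<close> by simp
    also have "\<dots> \<le> (\<Sum>i\<in>I. emeasure ?\<nu> (F i))"
    proof (rule sum_mono)
      fix i assume i: "i \<in> I"
      then have "snd i \<in> E" using T by (force simp: I_def)
      then show "ennreal (w / 2 * \<sigma> (fst i) powr Q) \<le> emeasure ?\<nu> (F i)"
        unfolding F_def using \<rho> \<sigma>_le[of "fst i"] \<sigma>_pos by (intro shell) auto
    qed
    also have "\<dots> = emeasure ?\<nu> (\<Union>i\<in>I. F i)"
      by (rule sum_emeasure[OF _ disj \<open>finite I\<close>]) (auto simp del: mem_ball simp: F_def borel_shell)
    also have "\<dots> \<le> emeasure ?\<nu> (ball y (2 * \<rho>))"
    proof (intro emeasure_mono UN_least subsetI)
      fix i x assume "i \<in> I" "x \<in> F i"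
      then have "dist y (snd i) < \<rho>" "dist (snd i) x < \<rho>"
        using T \<sigma>_le[of "fst i"] by (force simp: I_def, auto simp: F_def)
      then show "x \<in> ball y (2 * \<rho>)" using dist_triangle[of y x "snd i"] by simp
    qed auto
    also have "\<dots> \<le> ennreal (C * (2 * \<rho>) powr Q)"
      using A y \<rho> by (auto simp: Aikawa_condition_def)
    finally have le: "(\<Sum>i\<in>I. w / 2 * \<sigma> (fst i) powr Q) \<le> C * (2 * \<rho>) powr Q"
      using \<open>C > 0\<close> by (subst (asm) ennreal_le_iff) auto
    have \<sigma>_powr: "\<sigma> j powr Q = (\<eta> ^ j) powr Q * (\<rho> powr Q / 2 powr Q)" for j
      using \<eta> \<rho> by (simp add: \<sigma>_def powr_divide powr_mult)
    have "4 powr Q = 2 powr Q * (2 powr Q :: real)" by (simp flip: powr_mult)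
    then have D_eq: "C * (2 * \<rho>) powr Q = w / 2 * (\<rho> powr Q / 2 powr Q) * D"
      using \<open>w > 0\<close> \<rho> by (simp add: D_def powr_mult)
    have "(\<Sum>i\<in>I. w / 2 * \<sigma> (fst i) powr Q) = (\<Sum>j\<in>{1..N}. \<Sum>z\<in>T j. w / 2 * \<sigma> j powr Q)"
      unfolding I_def using T by (subst sum.Sigma) (auto simp: case_prod_beta)
    also have "\<dots> = w / 2 * (\<rho> powr Q / 2 powr Q) * (\<Sum>j\<in>{1..N}. real (card (T j)) * (\<eta> ^ j) powr Q)"
      by (simp add: sum_distrib_left \<sigma>_powr mult_ac)
    finally have "w / 2 * (\<rho> powr Q / 2 powr Q) * (\<Sum>j\<in>{1..N}. real (card (T j)) * (\<eta> ^ j) powr Q)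
        \<le> w / 2 * (\<rho> powr Q / 2 powr Q) * D"
      using le D_eq by simp
    then show ?thesis
      using \<open>w > 0\<close> \<rho> by (subst (asm) mult_le_cancel_left_pos) auto
  qed
  show ?thesis
  proof (rule exI[of _ \<eta>], rule exI[of _ D], intro conjI ballI allI impI)
    fix y \<rho> N T
    assume "y \<in> E" and "0 < \<rho> \<and> \<rho> \<le> r\<^sub>0 / 2 \<and>
      (\<forall>j\<in>{1..N}. finite (T j) \<and> T j \<subseteq> E \<inter> ball y \<rho> \<and> separated (\<eta> ^ j * \<rho>) (T j))"
    then show "(\<Sum>j\<in>{1..N}. real (card (T j)) * (\<eta> ^ j) powr Q) \<le> D"
      by (intro sum_le[of y \<rho>]) auto
  qed (use \<eta> \<open>D > 0\<close> in auto)
qed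

text \<open>
  Every ball of small radius \<open>\<rho>\<close> centred in \<open>E\<close> is covered, within \<open>E\<close>, by balls of a comparable but
  smaller radius, in such a way that the sum of the \<open>l\<close>-th powers of the radii does not increase.
\<close>

definition has_efficient_covers :: "'a::metric_space set \<Rightarrow> real \<Rightarrow> real \<Rightarrow> real \<Rightarrow> bool" where
  "has_efficient_covers E \<mu> l r\<^sub>1 \<longleftrightarrow> (\<forall>y\<in>E. \<forall>\<rho>. 0 < \<rho> \<and> \<rho> \<le> r\<^sub>1 \<longrightarrow>
     (\<exists>T \<rho>'. finite T \<and> T \<subseteq> E \<and> \<mu> * \<rho> \<le> \<rho>' \<and> \<rho>' \<le> \<rho> / 2 \<and>
        E \<inter> ball y \<rho> \<subseteq> (\<Union>z\<in>T. ball z \<rho>') \<and> real (card T) * \<rho>' powr l \<le> \<rho> powr l))"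

text \<open>
  Pigeonhole principle: if all of \<open>N \<ge> 2D\<close> scales had a normalised covering number above \<open>1/2\<close>, their
  sum would exceed \<open>D\<close>. At a scale with a value of at most \<open>1/2\<close> the exponent \<open>Q\<close> can be lowered by
  \<open>\<kappa>\<close>, at the price of a factor \<open>\<eta>\<^bsup>-N\<kappa>\<^esup>\<close>. The good scale depends on the ball, but only \<open>N\<close> scales
  occur, so one \<open>\<kappa>\<close> with \<open>\<eta>\<^bsup>-N\<kappa>\<^esup> \<le> 2\<close> serves all balls.
\<close>

lemma Aikawa_imp_efficient_covers:
  fixes H :: "'a::euclidean_space set"
  assumes "closed H" "E \<subseteq> H" "bounded E" and Q: "0 < Q" "Q < real DIM('a)" and "C > 0"
    and A: "Aikawa_condition H E Q r\<^sub>0 C"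
  shows "\<exists>\<mu> Q'. 0 < \<mu> \<and> \<mu> \<le> 1 \<and> 0 \<le> Q' \<and> Q' < Q \<and>
    has_efficient_covers E \<mu> Q' (r\<^sub>0 / 2)"
proof -
  obtain \<eta> D where \<eta>: "0 < \<eta>" "\<eta> \<le> 1 / 2" and "D > 0"
    and multi: "\<forall>y\<in>E. \<forall>\<rho> N T. 0 < \<rho> \<and> \<rho> \<le> r\<^sub>0 / 2 \<and>
      (\<forall>j\<in>{1..N}. finite (T j) \<and> T j \<subseteq> E \<inter> ball y \<rho> \<and> separated (\<eta> ^ j * \<rho>) (T j)) \<longrightarrow>
      (\<Sum>j\<in>{1..N}. real (card (T j)) * (\<eta> ^ j) powr Q) \<le> D"
    using Aikawa_multiscale_sum[OF assms(1,2) Q(2) \<open>C > 0\<close> A] by blast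
  define N where "N = nat \<lceil>2 * D\<rceil>"
  have N: "2 * D \<le> real N" "N > 0" using \<open>D > 0\<close> by (auto simp: N_def)
  define \<kappa> where "\<kappa> = min Q (ln 2 / (real N * ln (1 / \<eta>)))"
  have ln_pos: "ln (1 / \<eta>) > 0" using \<eta> by (intro ln_gt_zero) auto
  then have \<kappa>: "0 < \<kappa>" "\<kappa> \<le> Q" using Q N by (auto simp: \<kappa>_def)
  have "\<kappa> \<le> ln 2 / (real N * ln (1 / \<eta>))" by (simp add: \<kappa>_def)
  then have "\<kappa> * (real N * ln (1 / \<eta>)) \<le> ln 2"
    using ln_pos N by (subst (asm) pos_le_divide_eq) auto
  then have "exp (\<kappa> * (real N * ln (1 / \<eta>))) \<le> 2"
    by (metis exp_le_cancel_iff exp_ln zero_less_numeral)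
  then have loss: "(\<eta> ^ N) powr (- \<kappa>) \<le> 2"
    using \<eta> by (simp add: powr_def ln_realpow ln_div mult_ac)
  have step: "\<exists>T \<rho>'. finite T \<and> T \<subseteq> E \<and> \<eta> ^ N * \<rho> \<le> \<rho>' \<and> \<rho>' \<le> \<rho> / 2 \<and>
        E \<inter> ball y \<rho> \<subseteq> (\<Union>z\<in>T. ball z \<rho>') \<and> real (card T) * \<rho>' powr (Q - \<kappa>) \<le> \<rho> powr (Q - \<kappa>)"
    if y: "y \<in> E" and \<rho>: "0 < \<rho>" "\<rho> \<le> r\<^sub>0 / 2" for y \<rho>
  proof -
    have "\<exists>S. finite S \<and> S \<subseteq> E \<inter> ball y \<rho> \<and> separated (\<eta> ^ j * \<rho>) S \<and>
        E \<inter> ball y \<rho> \<subseteq> (\<Union>x\<in>S. ball x (\<eta> ^ j * \<rho>))" for j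
      using \<open>bounded E\<close> \<eta> \<rho> by (intro exists_maximal_separated) auto
    then obtain T where T: "\<And>j. finite (T j)" "\<And>j. T j \<subseteq> E \<inter> ball y \<rho>"
        "\<And>j. separated (\<eta> ^ j * \<rho>) (T j)" "\<And>j. E \<inter> ball y \<rho> \<subseteq> (\<Union>x\<in>T j. ball x (\<eta> ^ j * \<rho>))"
      by metis
    obtain j where j: "j \<in> {1..N}" "real (card (T j)) * (\<eta> ^ j) powr Q \<le> 1 / 2"
    proof (rule ccontr)
      assume "\<not> thesis"
      then have "\<And>j. j \<in> {1..N} \<Longrightarrow> 1 / 2 < real (card (T j)) * (\<eta> ^ j) powr Q"
        using that by force
      then have "(\<Sum>j\<in>{1..N}. 1 / 2 :: real) < (\<Sum>j\<in>{1..N}. real (card (T j)) * (\<eta> ^ j) powr Q)"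
        using N by (intro sum_strict_mono) auto
      also have "\<dots> \<le> D" by (rule multi[rule_format, OF y]) (use \<rho> T in auto)
      finally show False using N by simp
    qed
    have "\<eta> ^ N \<le> \<eta> ^ j" using \<eta> j by (intro power_decreasing) auto
    have "\<eta> ^ j \<le> \<eta> ^ 1" using \<eta> j by (intro power_decreasing) auto
    have "(\<eta> ^ j) powr (- \<kappa>) \<le> (\<eta> ^ N) powr (- \<kappa>)"
      using \<eta> \<kappa> \<open>\<eta> ^ N \<le> \<eta> ^ j\<close> by (intro powr_mono2') auto
    with loss have loss_j: "(\<eta> ^ j) powr (- \<kappa>) \<le> 2" by simp
    have "real (card (T j)) * (\<eta> ^ j * \<rho>) powr (Q - \<kappa>)
        = (real (card (T j)) * (\<eta> ^ j) powr Q) * (\<eta> ^ j) powr (- \<kappa>) * \<rho> powr (Q - \<kappa>)"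
      using powr_add[of "\<eta> ^ j" Q "- \<kappa>"] by (simp add: powr_mult)
    also have "\<dots> \<le> 1 / 2 * 2 * \<rho> powr (Q - \<kappa>)"
      using j(2) loss_j by (intro mult_right_mono mult_mono) auto
    finally have "real (card (T j)) * (\<eta> ^ j * \<rho>) powr (Q - \<kappa>) \<le> \<rho> powr (Q - \<kappa>)" by simp
    moreover have "\<eta> ^ N * \<rho> \<le> \<eta> ^ j * \<rho>"
      using \<open>\<eta> ^ N \<le> \<eta> ^ j\<close> \<rho> by simp
    moreover have "\<eta> ^ j * \<rho> \<le> 1 / 2 * \<rho>"
      using \<open>\<eta> ^ j \<le> \<eta> ^ 1\<close> \<eta> \<rho> by (intro mult_right_mono) auto
    ultimately show ?thesis
      using T[of j] by (intro exI[of _ "T j"] exI[of _ "\<eta> ^ j * \<rho>"]) auto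
  qed
  show ?thesis
  proof (rule exI[of _ "\<eta> ^ N"], rule exI[of _ "Q - \<kappa>"], unfold has_efficient_covers_def, intro conjI ballI allI impI)
    fix y \<rho> assume "y \<in> E" "0 < \<rho> \<and> \<rho> \<le> r\<^sub>0 / 2"
    then show "\<exists>T \<rho>'. finite T \<and> T \<subseteq> E \<and> \<eta> ^ N * \<rho> \<le> \<rho>' \<and> \<rho>' \<le> \<rho> / 2 \<and>
        E \<inter> ball y \<rho> \<subseteq> (\<Union>z\<in>T. ball z \<rho>') \<and> real (card T) * \<rho>' powr (Q - \<kappa>) \<le> \<rho> powr (Q - \<kappa>)"
      by (intro step) auto
  qed (use \<eta> \<kappa> in \<open>auto intro: power_le_one\<close>)
qed

text \<open>
  Induction on the number \<open>k\<close> of halvings that bring the radius down to \<open>t/2\<close>, where a ball contains at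
  most one point of \<open>S\<close>. Passing to an efficient cover preserves the bound, because the sum of the
  \<open>l\<close>-th powers of the radii does not increase. The number \<open>\<mu> t/2\<close> is a lower bound for all radii
  that occur, since only balls of radius above \<open>t/2\<close> are subdivided.
\<close>

lemma efficient_covers_imp_card_le:
  fixes E :: "'a::euclidean_space set"
  assumes \<mu>: "0 < \<mu>" "\<mu> \<le> 1" and "0 \<le> l"
    and cover: "has_efficient_covers E \<mu> l r\<^sub>1"
    and "t > 0" "separated t S" "finite S" "S \<subseteq> E"
    and "y \<in> E" "\<mu> * (t / 2) \<le> \<rho>" "\<rho> \<le> r\<^sub>1" "\<rho> \<le> 2 ^ k * (t / 2)"
  shows "real (card (S \<inter> ball y \<rho>)) \<le> (\<rho> / (\<mu> * (t / 2))) powr l"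
  using assms(9-)
proof (induction k arbitrary: y \<rho>)
  have small: "real (card (S \<inter> ball y \<rho>)) \<le> (\<rho> / (\<mu> * (t / 2))) powr l"
    if "\<rho> \<le> t / 2" "\<mu> * (t / 2) \<le> \<rho>" for y \<rho>
  proof -
    have "card (S \<inter> ball y \<rho>) \<le> 1"
      using that pairwise_subset[OF \<open>separated t S\<close>] by (intro separated_card_le_1[of t _ y \<rho>]) auto
    moreover have "1 \<le> (\<rho> / (\<mu> * (t / 2))) powr l"
      using that \<mu> \<open>t > 0\<close> \<open>0 \<le> l\<close> by (intro ge_one_powr_ge_zero) auto
    ultimately show ?thesis by linarith
  qed
  {
    case 0
    then show ?case using small by simp
  next
    case (Suc k)
    show ?case
    proof (cases "\<rho> \<le> t / 2")
      case True
      then show ?thesis using small Suc.prems by blast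
    next
      case False
      then have "\<rho> > 0" using \<open>t > 0\<close> by simp
      obtain T \<rho>' where T: "finite T" "T \<subseteq> E" "\<mu> * \<rho> \<le> \<rho>'" "\<rho>' \<le> \<rho> / 2"
        "E \<inter> ball y \<rho> \<subseteq> (\<Union>z\<in>T. ball z \<rho>')" "real (card T) * \<rho>' powr l \<le> \<rho> powr l"
        using cover \<open>y \<in> E\<close> \<open>\<rho> > 0\<close> \<open>\<rho> \<le> r\<^sub>1\<close> unfolding has_efficient_covers_def by meson
      have "\<mu> * (t / 2) \<le> \<mu> * \<rho>" using False \<mu> by (intro mult_left_mono) auto
      then have \<rho>': "\<mu> * (t / 2) \<le> \<rho>'" "\<rho>' \<le> r\<^sub>1" "\<rho>' \<le> 2 ^ k * (t / 2)" "\<rho>' > 0"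
        using T(3,4) Suc.prems \<open>\<rho> > 0\<close> mult_pos_pos[OF \<mu>(1) \<open>\<rho> > 0\<close>] by auto
      have "S \<inter> ball y \<rho> \<subseteq> (\<Union>z\<in>T. S \<inter> ball z \<rho>')" using T(5) \<open>S \<subseteq> E\<close> by blast
      then have "card (S \<inter> ball y \<rho>) \<le> card (\<Union>z\<in>T. S \<inter> ball z \<rho>')"
        using T(1) \<open>finite S\<close> by (intro card_mono) auto
      also have "\<dots> \<le> (\<Sum>z\<in>T. card (S \<inter> ball z \<rho>'))"
        by (rule card_UN_le[OF T(1)])
      finally have "real (card (S \<inter> ball y \<rho>)) \<le> (\<Sum>z\<in>T. real (card (S \<inter> ball z \<rho>')))"
        by (simp flip: of_nat_sum)
      also have "\<dots> \<le> (\<Sum>z\<in>T. (\<rho>' / (\<mu> * (t / 2))) powr l)"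
        using T(2) \<rho>' by (intro sum_mono Suc.IH) auto
      also have "\<dots> = real (card T) * \<rho>' powr l / (\<mu> * (t / 2)) powr l"
        using \<rho>' \<mu> \<open>t > 0\<close> powr_divide[of \<rho>' "\<mu> * (t / 2)" l] by simp
      also have "\<dots> \<le> \<rho> powr l / (\<mu> * (t / 2)) powr l"
        by (intro divide_right_mono T(6)) auto
      also have "\<dots> = (\<rho> / (\<mu> * (t / 2))) powr l"
        by (rule powr_divide[symmetric])
      finally show ?thesis .
    qed
  }
qed

text \<open>
  For radii up to \<open>r\<^sub>0 / 2\<close> the efficient covers give the count directly. Larger radii are reduced to
  these by a fixed finite cover of the bounded set \<open>E\<close>.
\<close>

lemma Aikawa_imp_assouad_dim_less:
  fixes H :: "'a::euclidean_space set"
  assumes "closed H" "E \<subseteq> H" "bounded E" and Q: "0 < Q" "Q < real DIM('a)" and "C > 0" "r\<^sub>0 > 0"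
    and A: "Aikawa_condition H E Q r\<^sub>0 C"
  shows "assouad_dim E < ereal Q"
proof -
  define r\<^sub>1 where "r\<^sub>1 = r\<^sub>0 / 2"
  have "r\<^sub>1 > 0" using \<open>r\<^sub>0 > 0\<close> by (simp add: r\<^sub>1_def)
  obtain \<mu> l where \<mu>: "0 < \<mu>" "\<mu> \<le> 1" and l: "0 \<le> l" "l < Q"
    and cover: "has_efficient_covers E \<mu> l r\<^sub>1"
    using Aikawa_imp_efficient_covers[OF assms(1-6) A] unfolding r\<^sub>1_def by blast
  have local: "real (card (S \<inter> ball y \<rho>)) \<le> (2 / \<mu>) powr l * (R / t) powr l"
    if "0 < t" "t < R" "separated t S" "finite S" "S \<subseteq> E" "y \<in> E" "\<rho> \<le> r\<^sub>1" "\<rho> \<le> R"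
    for t R S y \<rho>
  proof (cases "\<rho> \<le> \<mu> * (t / 2)")
    case True
    have "\<mu> * (t / 2) \<le> 1 * (t / 2)" using \<mu> that by (intro mult_right_mono) auto
    then have "\<rho> \<le> t / 2" using True by linarith
    then have "card (S \<inter> ball y \<rho>) \<le> 1"
      using pairwise_subset[OF \<open>separated t S\<close>]
      by (intro separated_card_le_1[of t _ y \<rho>]) auto
    moreover have "1 \<le> (2 / \<mu>) powr l * (R / t) powr l"
      using \<mu> l that mult_mono[of 1 "(2 / \<mu>) powr l" 1 "(R / t) powr l"]
      by (auto simp: ge_one_powr_ge_zero)
    ultimately show ?thesis by linarith
  next
    case False
    then have "\<rho> > 0" using \<mu> that mult_pos_pos[of \<mu> "t / 2"] by linarith
    obtain k where "\<rho> / (t / 2) < 2 ^ k" using real_arch_pow[of 2 "\<rho> / (t / 2)"] by auto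
    then have "\<rho> \<le> 2 ^ k * (t / 2)" using that by (simp add: field_simps)
    then have "real (card (S \<inter> ball y \<rho>)) \<le> (\<rho> / (\<mu> * (t / 2))) powr l"
      using False that by (intro efficient_covers_imp_card_le[OF \<mu> l(1) cover]) auto
    also have "\<dots> \<le> (R / (\<mu> * (t / 2))) powr l"
      using that \<mu> l \<open>\<rho> > 0\<close> by (intro powr_mono2 divide_right_mono) auto
    also have "R / (\<mu> * (t / 2)) = (2 / \<mu>) * (R / t)" by simp
    also have "\<dots> powr l = (2 / \<mu>) powr l * (R / t) powr l"
      by (rule powr_mult)
    finally show ?thesis .
  qed
  obtain N where N: "finite N" "N \<subseteq> E" "E \<subseteq> (\<Union>x\<in>N. ball x r\<^sub>1)"
    using exists_maximal_separated[OF \<open>bounded E\<close> \<open>r\<^sub>1 > 0\<close>] by blast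
  have "assouad_dim E \<le> ereal l"
  proof (rule assouad_dim_le[where C = "(real (card N) + 1) * (2 / \<mu>) powr l"])
    fix x t R S
    assume x: "x \<in> E" and t: "0 < t" "t < R" and S: "finite S" "S \<subseteq> E \<inter> ball x R" "separated t S"
    let ?b = "(2 / \<mu>) powr l * (R / t) powr l"
    have "real (card S) \<le> (real (card N) + 1) * ?b"
    proof (cases "R \<le> r\<^sub>1")
      case True
      have "S \<inter> ball x R = S" using S by auto
      then have "real (card S) \<le> ?b"
        using local[of t R S x R] t S x True by auto
      also have "\<dots> \<le> (real (card N) + 1) * ?b" by (simp add: algebra_simps)
      finally show ?thesis .
    next
      case False
      have "S = (\<Union>z\<in>N. S \<inter> ball z r\<^sub>1)" using N S by auto
      then have "card S \<le> (\<Sum>z\<in>N. card (S \<inter> ball z r\<^sub>1))"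
        using card_UN_le[OF N(1), of "\<lambda>z. S \<inter> ball z r\<^sub>1"] by simp
      then have "real (card S) \<le> (\<Sum>z\<in>N. real (card (S \<inter> ball z r\<^sub>1)))"
        by (simp flip: of_nat_sum)
      also have "\<dots> \<le> (\<Sum>z\<in>N. ?b)"
        using t S N False by (intro sum_mono local) auto
      also have "\<dots> \<le> (real (card N) + 1) * ?b" by (simp add: algebra_simps)
      finally show ?thesis .
    qed
    then show "real (card S) \<le> (real (card N) + 1) * (2 / \<mu>) powr l * (R / t) powr l"
      by (simp add: mult.assoc)
  qed (use \<open>bounded E\<close> l \<mu> in auto)
  also have "ereal l < ereal Q" using l by simp
  finally show ?thesis .
qed


section \<open>From the Hardy--Sobolev inequality to the Aikawa condition\<close>

text \<open>
  The segment from \<open>x\<close> to a nearest point of the complement meets the frontier.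
\<close>

lemma infdist_frontier_eq:
  fixes G :: "'a::euclidean_space set"
  assumes "open G" "frontier G \<noteq> {}" "x \<in> G"
  shows "infdist x (frontier G) = infdist x (- G)"
proof (rule antisym)
  have sub: "frontier G \<subseteq> - G"
    using \<open>open G\<close> by (auto simp: frontier_def interior_open)
  then have "- G \<noteq> {}" using assms by auto
  then obtain z where z: "z \<in> - G" "infdist x (- G) = dist x z"
    using infdist_attains_inf[of "- G" x] \<open>open G\<close> by auto
  have "closed_segment x z \<inter> frontier G \<noteq> {}"
    using z \<open>x \<in> G\<close> by (intro connected_Int_frontier) auto
  then obtain w where w: "w \<in> closed_segment x z" "w \<in> frontier G" by auto
  have "infdist x (frontier G) \<le> dist x w" using w by (intro infdist_le)
  also have "\<dots> \<le> dist x z"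
    using w segment_bound(1)[of w x z] by (simp add: dist_norm norm_minus_commute)
  finally show "infdist x (frontier G) \<le> infdist x (- G)" using z by simp
  show "infdist x (- G) \<le> infdist x (frontier G)"
    using sub assms by (intro infdist_mono) auto
qed

text \<open>
  Each of the balls is centred outside \<open>G\<close>, so the distance to the frontier is at most twice the radius
  on the part of the doubled ball inside \<open>G\<close>. Hence a ball of radius \<open>a\<close> contributes a multiple of
  \<open>a\<^bsup>-p\<^esup> a\<^sup>\<beta> a\<^sup>n = a\<^sup>s\<close>. An integrable majorant of the integrand is enough for the
  estimate, because the Bochner integral of a function that is not integrable is \<open>0\<close>.
\<close>

lemma cutoff_energy_le:
  fixes F :: "'a::euclidean_space \<Rightarrow> real" and G :: "'a set"
  assumes p: "p \<ge> 1" and "\<beta> \<ge> 0" "K > 0" and G: "open G" "frontier G \<noteq> {}"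
    and I: "finite I" "\<And>i. i \<in> I \<Longrightarrow> \<rho> i > 0 \<and> z i \<notin> G" and y: "y \<notin> G" "r > 0"
    and bound: "\<And>x. norm (grad F x) powr p \<le> K * (r powr (- p) * indicator (cball y (2 * r)) x +
         (\<Sum>i\<in>I. \<rho> i powr (- p) * indicator (cball (z i) (2 * \<rho> i)) x))"
  defines "s \<equiv> real DIM('a) - p + \<beta>"
  shows "(LINT x:G|lborel. norm (grad F x) powr p * infdist x (frontier G) powr \<beta>)
    \<le> K * 2 powr (\<beta> + DIM('a)) * unit_ball_vol (DIM('a)) * (r powr s + (\<Sum>i\<in>I. \<rho> i powr s))"
proof -
  define w where "w = unit_ball_vol (real DIM('a))"
  define h where "h c a x = a powr (- p) * (2 * a) powr \<beta> * indicator (cball c (2 * a)) x"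
    for c :: 'a and a x
  have h_integrable: "integrable lborel (h c a)" for c a
    unfolding h_def by (intro integrable_mult_right integrable_real_indicator) (auto simp del: infinity_ennreal_def simp: emeasure_bounded_finite)
  have h_integral: "(LINT x|lborel. h c a x) = 2 powr (\<beta> + DIM('a)) * w * a powr s" if "a > 0" for c a
  proof -
    have "(LINT x|lborel. h c a x) = a powr (- p) * (2 * a) powr \<beta> * (w * (2 * a) ^ DIM('a))"
      using that by (simp add: h_def content_cball w_def)
    also have "(2 * a) ^ DIM('a) = (2 * a) powr real DIM('a)"
      using that by (simp add: powr_realpow)
    finally show ?thesis
      using that by (simp add: s_def powr_mult powr_add powr_diff powr_minus field_simps)
  qed
  have weight: "a powr (- p) * indicator (cball c (2 * a)) x * infdist x (frontier G) powr \<beta> \<le> h c a x"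
    if "x \<in> G" "c \<notin> G" for a c x
  proof (cases "x \<in> cball c (2 * a)")
    case True
    have "infdist x (frontier G) \<le> dist x c"
      unfolding infdist_frontier_eq[OF G \<open>x \<in> G\<close>] using that by (intro infdist_le) auto
    then have "infdist x (frontier G) powr \<beta> \<le> (2 * a) powr \<beta>"
      using True \<open>\<beta> \<ge> 0\<close> by (intro powr_mono2) (auto simp: dist_commute infdist_nonneg)
    then show ?thesis using True by (simp add: h_def mult_left_mono)
  qed (simp add: h_def)
  have pointwise: "indicator G x *\<^sub>R (norm (grad F x) powr p * infdist x (frontier G) powr \<beta>)
      \<le> K * (h y r x + (\<Sum>i\<in>I. h (z i) (\<rho> i) x))" for x
  proof (cases "x \<in> G")
    case True
    have "norm (grad F x) powr p * infdist x (frontier G) powr \<beta>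
      \<le> K * (r powr (- p) * indicator (cball y (2 * r)) x +
         (\<Sum>i\<in>I. \<rho> i powr (- p) * indicator (cball (z i) (2 * \<rho> i)) x)) * infdist x (frontier G) powr \<beta>"
      by (intro mult_right_mono bound) auto
    also have "\<dots> = K * (r powr (- p) * indicator (cball y (2 * r)) x * infdist x (frontier G) powr \<beta> +
         (\<Sum>i\<in>I. \<rho> i powr (- p) * indicator (cball (z i) (2 * \<rho> i)) x * infdist x (frontier G) powr \<beta>))"
      by (simp only: sum_distrib_right mult.assoc distrib_right)
    also have "\<dots> \<le> K * (h y r x + (\<Sum>i\<in>I. h (z i) (\<rho> i) x))"
      using \<open>K > 0\<close> True y I by (intro mult_left_mono add_mono weight sum_mono) auto
    finally show ?thesis using True by simp
  next
    case False
    then show ?thesis using \<open>K > 0\<close> by (simp add: h_def sum_nonneg)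
  qed
  have "(LINT x:G|lborel. norm (grad F x) powr p * infdist x (frontier G) powr \<beta>)
      \<le> (LINT x|lborel. K * (h y r x + (\<Sum>i\<in>I. h (z i) (\<rho> i) x)))"
    unfolding set_lebesgue_integral_def
  proof (rule integral_mono')
    show "integrable lborel (\<lambda>x. K * (h y r x + (\<Sum>i\<in>I. h (z i) (\<rho> i) x)))"
      by (intro integrable_mult_right Bochner_Integration.integrable_add Bochner_Integration.integrable_sum h_integrable)
    show "0 \<le> K * (h y r x + (\<Sum>i\<in>I. h (z i) (\<rho> i) x))" for x
      using \<open>K > 0\<close> by (simp add: h_def sum_nonneg)
  qed (rule pointwise)
  also have "\<dots> = K * ((LINT x|lborel. h y r x) + (\<Sum>i\<in>I. (LINT x|lborel. h (z i) (\<rho> i) x)))"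
    by (simp add: h_integrable)
  also have "\<dots> = K * 2 powr (\<beta> + DIM('a)) * w * (r powr s + (\<Sum>i\<in>I. \<rho> i powr s))"
    using I y by (simp add: h_integral distrib_left mult.assoc flip: sum_distrib_left)
  finally show ?thesis by (simp add: w_def)
qed

text \<open>
  On the compact support of \<open>F\<close> the distance to the frontier is positive, so the integrand is continuous
  there for every exponent \<open>c\<close>.
\<close>

lemma test_function_weight_integrable:
  fixes F :: "'a::euclidean_space \<Rightarrow> real"
  assumes F: "test_function_on G F" and G: "open G" "frontier G \<noteq> {}" and "q > 0"
  shows "set_integrable lborel G (\<lambda>x. \<bar>F x\<bar> powr q * infdist x (frontier G) powr c)"
proof -
  define Z where "Z = closure {x. F x \<noteq> 0}"
  have Z: "compact Z" "Z \<subseteq> G" using F by (auto simp: test_function_on_def Z_def)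
  have "continuous_on UNIV F"
    using F unfolding test_function_on_def by (metis C_k.simps(1))
  then have cont_F: "continuous_on Z F" by (rule continuous_on_subset) auto
  have "x \<notin> frontier G" if "x \<in> Z" for x
    using that Z G(1) by (auto simp: frontier_def interior_open)
  then have pos: "infdist x (frontier G) > 0" if "x \<in> Z" for x
    using that G(2) by (intro infdist_pos_not_in_closed) auto
  have "continuous_on Z (\<lambda>x. \<bar>F x\<bar> powr q * infdist x (frontier G) powr c)"
    using \<open>q > 0\<close> pos cont_F
    by (intro continuous_on_mult continuous_on_powr' continuous_intros) (auto simp: infdist_nonneg less_imp_neq[THEN not_sym])
  from borel_integrable_compact[OF Z(1) this]
  have "integrable lborel (\<lambda>x. indicator Z x *\<^sub>R (\<bar>F x\<bar> powr q * infdist x (frontier G) powr c))" .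
  moreover have "indicator Z x *\<^sub>R (\<bar>F x\<bar> powr q * infdist x (frontier G) powr c)
      = indicator G x *\<^sub>R (\<bar>F x\<bar> powr q * infdist x (frontier G) powr c)" for x
  proof (cases "F x = 0")
    case False
    then have "x \<in> Z" unfolding Z_def using closure_subset by fast
    then show ?thesis using Z by auto
  qed simp
  ultimately show ?thesis unfolding set_integrable_def by (simp only:)
qed

text \<open>
  The inequality is applied to a cutoff that vanishes near \<open>- G \<inter> cball x\<^sub>0 (2 * R)\<close>. Fix a level \<open>t\<close> and
  choose the radii \<open>\<rho>\<^sub>i\<close> below \<open>t/2\<close>: then the doubled balls lie in the region where the distance to
  \<open>- G\<close> is less than \<open>t\<close>, and the cutoff is at least \<open>1\<close> on the rest of \<open>ball y r\<close>. So
  the integral over this rest is bounded by \<open>C r\<^sup>Q\<close> independently of \<open>t\<close>, and monotone convergence for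
  \<open>t \<rightarrow> 0\<close> gives the whole ball.
\<close>

lemma Hardy_Sobolev_imp_Aikawa:
  fixes G :: "'a::euclidean_space set"
  assumes G: "open G" "frontier G \<noteq> {}"
    and p: "1 \<le> p" "p \<le> q" "p < real DIM('a)" and "\<beta> \<ge> 0"
    and HS: "admits_Hardy_Sobolev G q p \<beta>" and "R > 0"
  defines "s \<equiv> real DIM('a) - p + \<beta>"
  assumes dim: "hausdorff_dim (- G \<inter> cball x\<^sub>0 (2 * R)) < ereal s" and s_le: "s \<le> real DIM('a)"
  shows "\<exists>C>0. Aikawa_condition (- G) (- G \<inter> cball x\<^sub>0 R) (q / p * s) (R / 2) C"
proof -
  define E where "E = - G \<inter> cball x\<^sub>0 (2 * R)"
  have "compact E" unfolding E_def using \<open>open G\<close> by (intro closed_Int_compact) auto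
  have dimE: "hausdorff_dim E < ereal s" using dim by (simp add: E_def)
  have "s > 0" using p \<open>\<beta> \<ge> 0\<close> by (simp add: s_def)
  define n where "n = real DIM('a)"
  define Q where "Q = q / p * s"
  define w where "w = unit_ball_vol n"
  obtain C where C: "C > 0" and hardy: "\<And>f. test_function_on G f \<Longrightarrow>
      (LINT x:G|lborel. \<bar>f x\<bar> powr q * infdist x (frontier G) powr (Q - n)) powr (1 / q)
        \<le> C * (LINT x:G|lborel. norm (grad f x) powr p * infdist x (frontier G) powr \<beta>) powr (1 / p)"
    using HS unfolding admits_Hardy_Sobolev_def Q_def s_def n_def by blast
  obtain K where "K > 0" and cutoff: "\<And>(I::nat set) z \<rho> (y::'a) r.
    finite I \<Longrightarrow> (\<forall>i\<in>I. \<rho> i > 0) \<Longrightarrow> r > 0 \<Longrightarrow>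
    (\<exists>F. is_cutoff p K I z \<rho> y r F)"
    using exists_cutoff[OF p(1)] by blast
  define D where "D = K * 2 powr (\<beta> + n) * w * 2"
  have "D > 0" using \<open>K > 0\<close> by (simp add: D_def w_def n_def)
  define C\<^sub>1 where "C\<^sub>1 = C powr q * D powr (q / p)"
  have "C\<^sub>1 > 0" using C \<open>D > 0\<close> by (simp add: C\<^sub>1_def)
  let ?\<nu> = "distance_weight (- G) Q"
  have level: "emeasure ?\<nu> {x \<in> ball y r. t \<le> infdist x (- G)} \<le> ennreal (C\<^sub>1 * r powr Q)"
    if y: "y \<in> - G \<inter> cball x\<^sub>0 R" and r: "0 < r" "r \<le> R / 2" and t: "t > 0" for y r t
  proof -
    \<comment> \<open>the first term keeps \<open>r\<^sup>s + \<Sum> \<rho>\<^sub>i\<^sup>s\<close> below \<open>2 r\<^sup>s\<close>, the second forces \<open>\<rho>\<^sub>i < t/2\<close>\<close>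
    define \<epsilon> where "\<epsilon> = min (r powr s) ((t / 2) powr s)"
    have "\<epsilon> > 0" using r t by (simp add: \<epsilon>_def)
    obtain I :: "nat set" and z \<rho> where I: "finite I" "\<And>i. i \<in> I \<Longrightarrow> z i \<in> E \<and> \<rho> i > 0"
      and cover: "E \<subseteq> (\<Union>i\<in>I. ball (z i) (\<rho> i))" and sum_less: "(\<Sum>i\<in>I. \<rho> i powr s) < \<epsilon>"
      using hausdorff_dim_less_imp_small_cover[OF \<open>compact E\<close> dimE \<open>\<epsilon> > 0\<close>] by blast
    have \<rho>_less: "2 * \<rho> i < t" if "i \<in> I" for i
    proof -
      have "\<rho> i powr s \<le> (\<Sum>i\<in>I. \<rho> i powr s)"
        using I(1) that by (intro member_le_sum) auto
      also have "\<dots> < (t / 2) powr s" using sum_less by (simp add: \<epsilon>_def)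
      finally have "\<rho> i < t / 2"
        using powr_less_cancel2[of s "\<rho> i" "t / 2"] \<open>s > 0\<close> t I(2)[OF that] by auto
      then show ?thesis by simp
    qed
    have "\<forall>i\<in>I. \<rho> i > 0" using I by blast
    from cutoff[where y = y and z = z, OF I(1) this r(1)]
    obtain F where smooth: "\<And>k. C_k k F"
      and support: "\<And>x. F x \<noteq> 0 \<Longrightarrow> x \<in> cball y (2 * r) - (\<Union>i\<in>I. ball (z i) (\<rho> i))"
      and one: "\<And>x. x \<in> ball y r - (\<Union>i\<in>I. cball (z i) (2 * \<rho> i)) \<Longrightarrow> F x \<ge> 1"
      and grad_bound: "\<And>x. norm (grad F x) powr p \<le> K * (r powr (- p) * indicator (cball y (2 * r)) x +
         (\<Sum>i\<in>I. \<rho> i powr (- p) * indicator (cball (z i) (2 * \<rho> i)) x))"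
      unfolding is_cutoff_def by blast
    define Z where "Z = cball y (2 * r) - (\<Union>i\<in>I. ball (z i) (\<rho> i))"
    have "compact Z" unfolding Z_def by (intro compact_diff) auto
    have Z_cl: "closure {x. F x \<noteq> 0} \<subseteq> Z"
      using support compact_imp_closed[OF \<open>compact Z\<close>] by (intro closure_minimal) (auto simp: Z_def)
    \<comment> \<open>the support stays in \<open>cball x\<^sub>0 (2 * R)\<close>, where the complement of \<open>G\<close> has been cut out\<close>
    have "x \<in> G" if "x \<in> Z" for x
    proof (rule ccontr)
      assume "x \<notin> G"
      have "dist x\<^sub>0 x \<le> dist x\<^sub>0 y + dist y x" by (rule dist_triangle)
      also have "\<dots> \<le> R + 2 * r" using y that by (intro add_mono) (auto simp: Z_def)
      finally have "x \<in> E" using \<open>x \<notin> G\<close> r by (simp add: E_def)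
      then show False using cover that by (auto simp: Z_def)
    qed
    moreover have "bounded {x. F x \<noteq> 0}"
      using bounded_subset[OF compact_imp_bounded[OF \<open>compact Z\<close>]] closure_subset Z_cl by blast
    ultimately have test: "test_function_on G F"
      unfolding test_function_on_def using smooth Z_cl by (auto simp: compact_closure)
    have "(LINT x:G|lborel. norm (grad F x) powr p * infdist x (frontier G) powr \<beta>)
        \<le> K * 2 powr (\<beta> + n) * w * (r powr s + (\<Sum>i\<in>I. \<rho> i powr s))"
      unfolding n_def w_def s_def
      by (rule cutoff_energy_le[OF p(1) \<open>\<beta> \<ge> 0\<close> \<open>K > 0\<close> G I(1) _ _ r(1) grad_bound])
         (use I(2) y in \<open>auto simp: E_def\<close>)
    also have "\<dots> \<le> K * 2 powr (\<beta> + n) * w * (2 * r powr s)"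
      using sum_less \<open>K > 0\<close> by (intro mult_left_mono) (auto simp: \<epsilon>_def w_def n_def)
    finally have energy: "(LINT x:G|lborel. norm (grad F x) powr p * infdist x (frontier G) powr \<beta>)
        \<le> D * r powr s" by (simp add: D_def mult.assoc)
    define J where "J = (LINT x:G|lborel. \<bar>F x\<bar> powr q * infdist x (frontier G) powr (Q - n))"
    have J_nonneg: "J \<ge> 0"
      unfolding J_def set_lebesgue_integral_def by (intro Bochner_Integration.integral_nonneg) auto
    have "J powr (1 / q) \<le> C * (LINT x:G|lborel. norm (grad F x) powr p * infdist x (frontier G) powr \<beta>) powr (1 / p)"
      unfolding J_def by (rule hardy[OF test])
    also have "\<dots> \<le> C * (D * r powr s) powr (1 / p)"
    proof -
      have "0 \<le> (LINT x:G|lborel. norm (grad F x) powr p * infdist x (frontier G) powr \<beta>)"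
        unfolding set_lebesgue_integral_def by (intro Bochner_Integration.integral_nonneg) auto
      then show ?thesis using energy C p by (intro mult_left_mono powr_mono2) auto
    qed
    finally have "(J powr (1 / q)) powr q \<le> (C * (D * r powr s) powr (1 / p)) powr q"
      using p by (intro powr_mono2) auto
    also have "\<dots> = C\<^sub>1 * r powr Q"
      using C \<open>D > 0\<close> r p by (simp add: C\<^sub>1_def Q_def powr_mult powr_powr mult_ac)
    finally have J_le: "J \<le> C\<^sub>1 * r powr Q"
      using J_nonneg p by (simp add: powr_powr)
    have "emeasure ?\<nu> {x \<in> ball y r. t \<le> infdist x (- G)}
        = (\<integral>\<^sup>+x. ennreal (infdist x (- G) powr (Q - n)) * indicator {x \<in> ball y r. t \<le> infdist x (- G)} x \<partial>lborel)"
      unfolding n_def using borel_shell by (subst emeasure_density) (auto simp del: mem_ball)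
    also have "\<dots> \<le> (\<integral>\<^sup>+x. ennreal (indicator G x *\<^sub>R (\<bar>F x\<bar> powr q * infdist x (frontier G) powr (Q - n))) \<partial>lborel)"
    proof (rule nn_integral_mono)
      fix x
      show "ennreal (infdist x (- G) powr (Q - n)) * indicator {x \<in> ball y r. t \<le> infdist x (- G)} x
          \<le> ennreal (indicator G x *\<^sub>R (\<bar>F x\<bar> powr q * infdist x (frontier G) powr (Q - n)))"
      proof (cases "x \<in> ball y r \<and> t \<le> infdist x (- G)")
        case True
        then have "x \<in> G" using t by (cases "x \<in> - G") auto
        have "x \<notin> cball (z i) (2 * \<rho> i)" if "i \<in> I" for i
        proof -
          have "infdist x (- G) \<le> dist x (z i)"
            using I(2)[OF that] by (intro infdist_le) (auto simp: E_def)
          then show ?thesis using True \<rho>_less[OF that] by (auto simp: dist_commute)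
        qed
        then have "F x \<ge> 1" using True by (intro one) auto
        then have "1 \<le> \<bar>F x\<bar> powr q" using p by (intro ge_one_powr_ge_zero) auto
        then have "1 * infdist x (- G) powr (Q - n) \<le> \<bar>F x\<bar> powr q * infdist x (- G) powr (Q - n)"
          by (intro mult_right_mono) auto
        then show ?thesis
          using True \<open>x \<in> G\<close> infdist_frontier_eq[OF G \<open>x \<in> G\<close>] by (simp add: ennreal_leI)
      qed auto
    qed
    also have "\<dots> = ennreal J"
      unfolding J_def set_lebesgue_integral_def
      using test_function_weight_integrable[OF test G, of q "Q - n"] p
      by (intro nn_integral_eq_integral) (auto simp: set_integrable_def)
    also have "\<dots> \<le> ennreal (C\<^sub>1 * r powr Q)" by (intro ennreal_leI J_le)
    finally show ?thesis .
  qed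
  have ball: "emeasure ?\<nu> (ball y r) \<le> ennreal (C\<^sub>1 * r powr Q)"
    if y: "y \<in> - G \<inter> cball x\<^sub>0 R" and r: "0 < r" "r \<le> R / 2" for y r
  proof -
    define A where "A k = {x \<in> ball y r. 1 / real (Suc k) \<le> infdist x (- G)}" for k
    have A_sets: "range A \<subseteq> sets ?\<nu>" using borel_shell by (auto simp: A_def)
    have "incseq A"
    proof (rule incseq_SucI)
      fix k
      have "1 / real (Suc (Suc k)) \<le> 1 / real (Suc k)" by (intro divide_left_mono) auto
      then show "A k \<le> A (Suc k)" unfolding A_def using order_trans by blast
    qed
    have UN: "(\<Union>k. A k) = {x \<in> ball y r. 0 < infdist x (- G)}"
    proof -
      have "(\<exists>k. 1 / real (Suc k) \<le> infdist x (- G)) \<longleftrightarrow> 0 < infdist x (- G)" for x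
      proof
        assume "\<exists>k. 1 / real (Suc k) \<le> infdist x (- G)"
        then obtain k where "1 / real (Suc k) \<le> infdist x (- G)" ..
        then show "0 < infdist x (- G)" by (rule less_le_trans[rotated]) simp
      next
        assume "0 < infdist x (- G)"
        then obtain k where "1 / real (Suc k) < infdist x (- G)" by (rule nat_approx_posE)
        then show "\<exists>k. 1 / real (Suc k) \<le> infdist x (- G)" by (intro exI[of _ k]) simp
      qed
      then show ?thesis unfolding A_def by (simp add: set_eq_iff)
    qed
    then have UN_sets: "{x \<in> ball y r. 0 < infdist x (- G)} \<in> sets lborel"
      using A_sets unfolding UN[symmetric] by (intro sets.countable_UN) auto
    have "emeasure ?\<nu> (ball y r) = (\<integral>\<^sup>+x. ennreal (infdist x (- G) powr (Q - DIM('a))) * indicator (ball y r) x \<partial>lborel)"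
      by (subst emeasure_density) auto
    also have "\<dots> = (\<integral>\<^sup>+x. ennreal (infdist x (- G) powr (Q - DIM('a))) *
        indicator {x \<in> ball y r. 0 < infdist x (- G)} x \<partial>lborel)"
      by (intro nn_integral_cong) (auto simp: indicator_def less_le infdist_nonneg)
    also have "\<dots> = emeasure ?\<nu> (\<Union>k. A k)"
      unfolding UN using UN_sets by (subst emeasure_density) auto
    also have "\<dots> = (SUP k. emeasure ?\<nu> (A k))"
      by (rule SUP_emeasure_incseq[symmetric, OF A_sets \<open>incseq A\<close>])
    also have "\<dots> \<le> ennreal (C\<^sub>1 * r powr Q)"
      unfolding A_def using y r by (intro SUP_least level) auto
    finally show ?thesis .
  qed
  have null: "emeasure lborel (ball y r \<inter> - G) = 0"
    if y: "y \<in> - G \<inter> cball x\<^sub>0 R" and r: "0 < r" "r \<le> R / 2" for y r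
  proof -
    have "ball y r \<subseteq> cball x\<^sub>0 (2 * R)"
    proof
      fix x assume "x \<in> ball y r"
      then show "x \<in> cball x\<^sub>0 (2 * R)"
        using dist_triangle[of x\<^sub>0 x y] y r \<open>R > 0\<close> by auto
    qed
    then have "emeasure lborel (ball y r \<inter> - G) \<le> emeasure lborel E"
      using \<open>compact E\<close> by (intro emeasure_mono) (auto simp: E_def borel_compact)
    also have "\<dots> = 0"
      by (rule null_if_hausdorff_dim_less[OF \<open>compact E\<close> dimE \<open>s > 0\<close> s_le])
    finally show ?thesis by simp
  qed
  show ?thesis
    unfolding Q_def[symmetric] Aikawa_condition_def
    using \<open>C\<^sub>1 > 0\<close> ball null by (intro exI[of _ C\<^sub>1]) blast
qed


section \<open>Dimension dichotomy for the complement\<close>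

theorem proposition8p1:
  fixes G :: "(real ^ 'n) set" and p q \<beta> :: real
  assumes "CARD('n) \<ge> 2"
    and "open G" and "G \<noteq> {}" and "frontier G \<noteq> {}"
    and "1 \<le> p" and "p \<le> q" and "p < real CARD('n)" and "q < real CARD('n) * p / (real CARD('n) - p)"
    and "\<beta> \<ge> 0"
    and "q * (real CARD('n) - p + \<beta>) / p \<noteq> real CARD('n)"
    and "admits_Hardy_Sobolev G q p \<beta>"
  shows "\<forall>x R. R > 0 \<longrightarrow>
     assouad_dim (- G \<inter> cball x R) < ereal (q / p * (real CARD('n) - p + \<beta>)) \<or>
     hausdorff_dim (- G \<inter> cball x (2 * R)) \<ge> ereal (real CARD('n) - p + \<beta>)"
proof (intro allI impI)
  fix x :: "real ^ 'n" and R :: real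
  assume "R > 0"
  define s where "s = real CARD('n) - p + \<beta>"
  define Q where "Q = q / p * s"
  have "s > 0" using assms by (simp add: s_def)
  have "s \<le> Q"
    using assms \<open>s > 0\<close> mult_right_mono[of 1 "q / p" s] by (simp add: Q_def)
  have "Q \<noteq> real CARD('n)" using assms(10) by (simp add: Q_def s_def)
  then consider "Q > real CARD('n)" | "Q < real CARD('n)" by linarith
  then show "assouad_dim (- G \<inter> cball x R) < ereal (q / p * (real CARD('n) - p + \<beta>)) \<or>
     hausdorff_dim (- G \<inter> cball x (2 * R)) \<ge> ereal (real CARD('n) - p + \<beta>)"
  proof cases
    case 1
    have "assouad_dim (- G \<inter> cball x R) \<le> ereal (DIM(real ^ 'n))"
      by (intro assouad_dim_le_DIM bounded_Int) auto
    also have "\<dots> < ereal Q" using 1 by simp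
    finally show ?thesis by (simp add: Q_def s_def)
  next
    case 2
    have "assouad_dim (- G \<inter> cball x R) < ereal Q"
      if dim: "hausdorff_dim (- G \<inter> cball x (2 * R)) < ereal s"
    proof -
      obtain C where "C > 0"
        and A: "Aikawa_condition (- G) (- G \<inter> cball x R) Q (R / 2) C"
        using Hardy_Sobolev_imp_Aikawa[of G p q \<beta> R x] assms \<open>R > 0\<close> dim 2 \<open>s \<le> Q\<close>
        by (auto simp: s_def Q_def)
      show ?thesis
        using assms \<open>s > 0\<close> \<open>s \<le> Q\<close> 2 \<open>C > 0\<close> \<open>R > 0\<close>
        by (intro Aikawa_imp_assouad_dim_less[OF _ _ _ _ _ _ _ A]) (auto intro: bounded_Int)
    qed
    then show ?thesis by (force simp: Q_def s_def not_le)
  qed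
qed

end
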